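(* Let $c\in C(0,\infty)$ be non-increasing with $c(0+)>0$, and assume $\Pi_S(0,\infty)=\infty$. If $c$ is differentiable on an open non-empty set $G\subset(0,\infty)$ and $S$ satisfies the continuous density condition, then $$\mathsf P\{\tau_c\in \mathrm dt,\ S(\tau_c)=c(\tau_c)\}=-c'(t)\,g_t(c(t))\,\mathrm dt,\qquad t\in G.$$
   Context: $S$ is a subordinator (non-decreasing Lévy process started at $0$) without drift, with Lévy measure $\Pi_S$ on $(0,\infty)$. $\tau_c=\inf\{t>0:S(t)>c(t)\}$. $C(0,\infty)$ is the set of continuous real functions on $(0,\infty)$. $S$ satisfies the continuous density condition if for each $t>0$, $S(t)$ has a probability density function (w.r.t. Lebesgue measure) $g_t$ on $(0,\infty)$, and $(t,x)\mapsto g_t(x)$ is continuous on $(0,\infty)\times(0,\infty)$. By convention $g_t(x)=0$ for $x\le 0$. The displayed equality is an equality of measures on $G$. *)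

theory Defs
  imports "HOL-Probability.Probability"
begin

text \<open>Processes are indexed by real times; only the times in \<open>{0..}\<close> are meaningful.
  Path properties are required of every sample path rather than almost surely, so that events
  involving the whole path are measurable without completing the probability space.\<close>

locale levy_process = prob_space M for M :: "'a measure" +
  fixes S :: "real \<Rightarrow> 'a \<Rightarrow> real"
  assumes random_variable_at: "\<And>t. 0 \<le> t \<Longrightarrow> random_variable borel (S t)"
    and start_zero: "AE \<omega> in M. S 0 \<omega> = 0"
    and right_continuous_paths:
      "\<And>\<omega> t. \<lbrakk>\<omega> \<in> space M; 0 \<le> t\<rbrakk> \<Longrightarrow> ((\<lambda>s. S s \<omega>) \<longlongrightarrow> S t \<omega>) (at_right t)"
    and left_limits_paths:
      "\<And>\<omega> t. \<lbrakk>\<omega> \<in> space M; 0 < t\<rbrakk> \<Longrightarrow> \<exists>l. ((\<lambda>s. S s \<omega>) \<longlongrightarrow> l) (at_left t)"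
    and independent_increments:
      "\<And>(n::nat) t. \<lbrakk>0 \<le> t 0; \<And>i. i < n \<Longrightarrow> t i < t (Suc i)\<rbrakk> \<Longrightarrow>
        indep_vars (\<lambda>_. borel) (\<lambda>i \<omega>. S (t (Suc i)) \<omega> - S (t i) \<omega>) {..<n}"
    and stationary_increments:
      "\<And>s h. \<lbrakk>0 \<le> s; 0 \<le> h\<rbrakk> \<Longrightarrow>
        distr M borel (\<lambda>\<omega>. S (s + h) \<omega> - S s \<omega>) = distr M borel (S h)"

locale subordinator = levy_process +
  assumes nondecreasing_paths: "\<And>\<omega>. \<omega> \<in> space M \<Longrightarrow> mono_on {0..} (\<lambda>t. S t \<omega>)"

text \<open>The measure \<open>\<nu>\<close> on \<open>(0,\<infinity>)\<close> is represented as a Borel measure on the whole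
  line which does not charge the non-positive half-line.\<close>

definition subordinator_levy_measure :: "real measure \<Rightarrow> bool" where
  "subordinator_levy_measure \<nu> \<longleftrightarrow>
     sets \<nu> = sets borel \<and> emeasure \<nu> {..0} = 0 \<and>
     (\<integral>\<^sup>+ x. ennreal (min 1 x) \<partial>\<nu>) < \<infinity>"

text \<open>The drift \<open>d\<close> and the Levy measure \<open>\<nu>\<close> are those of the Levy-Khintchine formula
  for the Laplace exponent of a subordinator.\<close>

definition has_drift_and_levy_measure ::
    "'a measure \<Rightarrow> (real \<Rightarrow> 'a \<Rightarrow> real) \<Rightarrow> real \<Rightarrow> real measure \<Rightarrow> bool" where
  "has_drift_and_levy_measure M S d \<nu> \<longleftrightarrow>
     0 \<le> d \<and> subordinator_levy_measure \<nu> \<and>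
     (\<forall>t\<ge>0. \<forall>q\<ge>0.
        (LINT \<omega>|M. exp (- q * S t \<omega>)) =
          exp (- t * (d * q + (LINT x|\<nu>. 1 - exp (- q * x)))))"

definition continuous_density_condition ::
    "'a measure \<Rightarrow> (real \<Rightarrow> 'a \<Rightarrow> real) \<Rightarrow> (real \<Rightarrow> real \<Rightarrow> real) \<Rightarrow> bool" where
  "continuous_density_condition M S g \<longleftrightarrow>
     (\<forall>t>0. (\<forall>x. 0 \<le> g t x) \<and> (\<forall>x\<le>0. g t x = 0) \<and>
        distributed M lborel (S t) (\<lambda>x. ennreal (g t x))) \<and>
     continuous_on ({0<..} \<times> {0<..}) (\<lambda>(t, x). g t x)"

text \<open>Extended-real valued, so that the infimum of the empty set is \<open>\<infinity>\<close>.\<close>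

definition crossing_time ::
    "(real \<Rightarrow> 'a \<Rightarrow> real) \<Rightarrow> (real \<Rightarrow> real) \<Rightarrow> 'a \<Rightarrow> ereal" where
  "crossing_time S c \<omega> = Inf {ereal t | t. 0 < t \<and> c t < S t \<omega>}"

end

theory Submission
  imports Defs
begin

text \<open>A statement about Lebesgue-almost every level says nothing about the single level 0 at
  which \<open>S - c\<close> has to be caught. Splitting off \<open>S p\<close> turns 0 into a
  random level with a density, independent of the later path, and then null sets of levels are
  harmless; the price is the convolution, which merges again to \<open>g t\<close> whatever
  \<open>p\<close> was chosen. The length of the image is the heart of the matter. The rise of
  \<open>F\<close> over an interval consists of the fall of \<open>c\<close> and the rise of
  \<open>S\<close>; without drift the latter is made of jumps only, and the gaps they leave are
  missing from the image. A drift delta would add delta * (b - a) to the length. The path has jumps,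
  so no derivative of \<open>F\<close> is available for a substitution. Instead the lengths of the
  images of half-open intervals identify the push-forward of Lebesgue measure under the passage map,
  which is the inverse of \<open>F\<close>. The lower bound on these lengths holds on each path, the
  upper bound only in expectation; together they force equality almost surely. The function e comes
  from the Laplace exponent: its quotient by q tends to 0 as q grows, and the truncation level is d
  = 1 / q.\<close>

text \<open>Fix \<open>0 < p\<close> and let \<open>Y t = S t - S p\<close> for \<open>t > p\<close>. Almost surely the path \<open>F = Y - c\<close> is
  strictly increasing, and since \<open>S\<close> has no drift the set \<open>F ` {a<..b}\<close> has Lebesgue measure
  \<open>c a - c b\<close>: at least this much because \<open>F t \<mapsto> c t\<close> is nonexpansive, and on average at most this
  much because \<open>E (min d (S h)) \<le> h * e d\<close> with \<open>e d \<rightarrow> 0\<close> as \<open>d \<rightarrow> 0\<close>. Hence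
  \<open>\<integral> f y * 1 (y \<in> F ` B) dy = \<integral>\<^sub>B f (F t) * (- c' t) dt\<close> pathwise.
  On the event in question the level \<open>- S p\<close>, which is independent of \<open>F\<close> and has density
  \<open>y \<mapsto> g p (- y)\<close>, belongs to \<open>F ` B\<close>, and conversely. Integrating, the probability of the event
  is \<open>\<integral>\<^sub>B (g p * g (t - p)) (c t) * (- c' t) dt\<close> with the convolution of the densities,
  which equals \<open>g t (c t)\<close> at every point by continuity.\<close>

section \<open>Lebesgue measure of images under monotone functions and passage times\<close>

text \<open>An open \<open>U\<close> around \<open>A\<close> has almost the length of
  \<open>A\<close>, and \<open>A\<close> is covered by non-overlapping closed intervals inside
  \<open>U\<close>. On the trace of \<open>A\<close> in each of them \<open>f\<close> oscillates by
  at most the length of that interval, so hulls of total length at most that of \<open>U\<close>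
  cover the image. No extension of \<open>f\<close> beyond \<open>A\<close> and no measurability of
  \<open>f\<close> enters.\<close>

lemma nonexpansive_image_interval_le:
  fixes f :: "real \<Rightarrow> real"
  assumes A: "A \<in> sets borel" "bounded A"
    and f: "\<And>x y. x \<in> A \<Longrightarrow> y \<in> A \<Longrightarrow> \<bar>f x - f y\<bar> \<le> \<bar>x - y\<bar>"
    and sub: "{u<..<v} \<subseteq> f ` A"
  shows "ennreal (v - u) \<le> emeasure lborel A"
proof (rule ennreal_le_epsilon)
  fix e :: real assume e: "0 < e"
  have "A \<in> sets lebesgue" using A by auto
  then obtain U where U: "open U" "A \<subseteq> U" "U - A \<in> lmeasurable" "emeasure lebesgue (U - A) < ennreal e"
    using sets_lebesgue_outer_open e by blast
  have mU: "emeasure lborel U \<le> emeasure lborel A + ennreal e"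
  proof -
    have "emeasure lborel U \<le> emeasure lborel A + emeasure lborel (U - A)"
      using A U by (subst plus_emeasure) (auto simp: Un_absorb1)
    also have "emeasure lborel (U - A) = emeasure lebesgue (U - A)"
      using A U by (subst emeasure_completion) (auto simp: borel_open)
    also have "emeasure lborel A + \<dots> \<le> emeasure lborel A + ennreal e"
      using U by (intro add_left_mono) auto
    finally show ?thesis .
  qed
  have "\<exists>r>0. x \<in> A \<longrightarrow> ball x r \<subseteq> U" for x
  proof (cases "x \<in> A")
    case True
    then obtain r where "0 < r" "ball x r \<subseteq> U" using U openE[of U x] by blast
    then show ?thesis by blast
  qed (auto intro: exI[of _ 1])
  then obtain r where r: "\<And>x. 0 < r x" "\<And>x. x \<in> A \<Longrightarrow> ball x (r x) \<subseteq> U" by metis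
  obtain a where a: "\<And>x. x \<in> A \<Longrightarrow> \<bar>x\<bar> \<le> a" "0 < a"
    using A(2) by (auto simp: bounded_real) (metis abs_ge_self add_pos_nonneg dual_order.trans gt_ex less_le_not_le linorder_not_le)
  obtain D where D: "countable D"
     "\<And>K. K \<in> D \<Longrightarrow> interior K \<noteq> {} \<and> (\<exists>c d. K = cbox c d)"
     "pairwise (\<lambda>A B. interior A \<inter> interior B = {}) D"
     "\<And>K. K \<in> D \<Longrightarrow> \<exists>x \<in> A \<inter> K. K \<subseteq> ball x (r x)" "A \<subseteq> \<Union>D"
  proof (rule covering_lemma[of A "-a" a "\<lambda>x. ball x (r x)"])
    show "A \<subseteq> cbox (- a) a" using a(1) by (force simp: abs_le_iff)
    show "box (- a) a \<noteq> {}" using a(2) by simp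
    show "gauge (\<lambda>x. ball x (r x))" using r by (auto simp: gauge_def)
  qed blast
  \<comment> \<open>The closed hull of the image of the trace of \<open>A\<close>. It is measurable
    whatever \<open>f\<close> is.\<close>
  define J where "J K = {Inf (f ` (A \<inter> K))..Sup (f ` (A \<inter> K))}" for K
  have J: "f ` (A \<inter> K) \<subseteq> J K \<and> emeasure lborel (J K) \<le> emeasure lborel (interior K) \<and> interior K \<subseteq> U"
    if K: "K \<in> D" for K
  proof -
    obtain c d where cd: "K = {c..d}" using D(2)[OF K] by auto
    obtain x where x: "x \<in> A" "x \<in> K" "K \<subseteq> ball x (r x)" using D(4)[OF K] by auto
    have diam: "f y - f z \<le> d - c" if "y \<in> A \<inter> K" "z \<in> A \<inter> K" for y z
      using f[of y z] that cd by auto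
    have bdd: "bdd_above (f ` (A \<inter> K))" "bdd_below (f ` (A \<inter> K))"
      using diam[of _ x] diam[of x] x
      by (auto intro!: bdd_aboveI[of _ "f x + (d - c)"] bdd_belowI[of _ "f x - (d - c)"] simp: algebra_simps)
    have ne: "f ` (A \<inter> K) \<noteq> {}" using x by auto
    have "Sup (f ` (A \<inter> K)) \<le> Inf (f ` (A \<inter> K)) + (d - c)"
    proof (rule cSup_least[OF ne])
      fix s assume "s \<in> f ` (A \<inter> K)"
      then obtain y where y: "y \<in> A \<inter> K" "s = f y" by auto
      have "s - (d - c) \<le> Inf (f ` (A \<inter> K))"
        using diam[OF y(1)] y by (intro cInf_greatest[OF ne]) (auto simp: algebra_simps)
      then show "s \<le> Inf (f ` (A \<inter> K)) + (d - c)" by simp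
    qed
    moreover have "Inf (f ` (A \<inter> K)) \<le> Sup (f ` (A \<inter> K))"
      by (rule cInf_le_cSup[OF ne bdd])
    moreover have "c \<le> d" using cd x by auto
    ultimately have "emeasure lborel (J K) \<le> emeasure lborel (interior K)"
      by (auto simp: J_def cd interior_atLeastAtMost_real intro!: ennreal_leI)
    moreover have "f ` (A \<inter> K) \<subseteq> J K"
      using bdd by (auto simp: J_def intro!: cInf_lower cSup_upper)
    moreover have "interior K \<subseteq> U" using x r(2) interior_subset[of K] by blast
    ultimately show ?thesis by blast
  qed
  have cov: "{u<..<v} \<subseteq> (\<Union>K\<in>D. J K)"
  proof
    fix y assume "y \<in> {u<..<v}"
    then obtain x where x: "x \<in> A" "y = f x" using sub by auto
    then obtain K where "K \<in> D" "x \<in> K" using D(5) by auto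
    then show "y \<in> (\<Union>K\<in>D. J K)" using J[of K] x by blast
  qed
  \<comment> \<open>Countable subadditivity over \<open>D\<close>, written as an integral over
    \<open>count_space D\<close> because \<open>D\<close> is not enumerated.\<close>
  have ind: "indicator {u<..<v} y \<le> (\<integral>\<^sup>+K. indicator (J K) y \<partial>count_space D)" for y
  proof (cases "y \<in> {u<..<v}")
    case True
    then obtain K where K: "K \<in> D" "y \<in> J K" using cov by blast
    have "(indicator (J K) y :: ennreal) \<le> (\<integral>\<^sup>+K. indicator (J K) y \<partial>count_space D)"
      by (rule nn_integral_ge_point[OF K(1)])
    then show ?thesis using K True by simp
  qed simp
  have "ennreal (v - u) = emeasure lborel {u<..<v}"
    by (cases "u \<le> v") (auto simp: ennreal_neg)
  also have "\<dots> = (\<integral>\<^sup>+y. indicator {u<..<v} y \<partial>lborel)" by simp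
  also have "\<dots> \<le> (\<integral>\<^sup>+y. \<integral>\<^sup>+K. indicator (J K) y \<partial>count_space D \<partial>lborel)"
    by (intro nn_integral_mono ind)
  also have "\<dots> = (\<integral>\<^sup>+K. \<integral>\<^sup>+y. indicator (J K) y \<partial>lborel \<partial>count_space D)"
    using D(1) by (intro nn_integral_count_space_nn_integral) (auto simp: J_def)
  also have "\<dots> = (\<integral>\<^sup>+K. emeasure lborel (J K) \<partial>count_space D)"
    by (intro nn_integral_cong nn_integral_indicator) (simp add: J_def)
  also have "\<dots> \<le> (\<integral>\<^sup>+K. emeasure lborel (interior K) \<partial>count_space D)"
    using J by (intro nn_integral_mono) simp
  also have "\<dots> = emeasure lborel (\<Union>K\<in>D. interior K)"
  proof (rule emeasure_UN_countable[symmetric])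
    show "disjoint_family_on interior D"
      using D(3) by (simp add: disjoint_family_on_def pairwise_def)
  qed (use D(1) in simp_all)
  also have "\<dots> \<le> emeasure lborel U"
  proof (rule emeasure_mono)
    show "(\<Union>K\<in>D. interior K) \<subseteq> U" using J by blast
  qed (use U(1) in simp)
  also have "\<dots> \<le> emeasure lborel A + ennreal e" by (rule mU)
  finally show "ennreal (v - u) \<le> emeasure lborel A + ennreal e" .
qed

text \<open>The time is replaced by a grid point to its right. For a fixed mesh only countably many
  times occur, so joint measurability follows from that of each \<open>f t\<close>; right-continuity
  gives the limit.\<close>

lemma measurable_pair_right_continuous:
  fixes f :: "real \<Rightarrow> 'a \<Rightarrow> real"
  assumes f: "\<And>t. f t \<in> borel_measurable N"
    and rc: "\<And>\<omega> t. \<omega> \<in> space N \<Longrightarrow> ((\<lambda>s. f s \<omega>) \<longlongrightarrow> f t \<omega>) (at_right t)"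
  shows "(\<lambda>(t, \<omega>). f t \<omega>) \<in> borel_measurable (borel \<Otimes>\<^sub>M N)"
proof -
  \<comment> \<open>Floor plus one keeps \<open>q n t\<close> strictly above \<open>t\<close>, even
    when \<open>t\<close> is a grid point, as convergence along \<open>at_right t\<close>
    demands.\<close>
  define q where "q n t = (of_int \<lfloor>t * real (Suc n)\<rfloor> + 1) / real (Suc n)" for n and t :: real
  have q: "t < q n t \<and> q n t \<le> t + 1 / real (Suc n)" for n t
  proof -
    define m where "m = real (Suc n)"
    have m: "0 < m" by (simp add: m_def)
    have "t * m < of_int \<lfloor>t * m\<rfloor> + 1" "of_int \<lfloor>t * m\<rfloor> + 1 \<le> t * m + 1" by linarith+
    then have "t < (of_int \<lfloor>t * m\<rfloor> + 1) / m" "(of_int \<lfloor>t * m\<rfloor> + 1) / m \<le> t + 1 / m"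
      using m by (simp_all add: pos_less_divide_eq pos_divide_le_eq distrib_right)
    then show ?thesis by (simp add: q_def m_def)
  qed
  have qlim: "filterlim (\<lambda>n. q n t) (at_right t) sequentially" for t
    unfolding filterlim_at
  proof
    show "\<forall>\<^sub>F n in sequentially. q n t \<in> {t<..} \<and> q n t \<noteq> t"

    proof (intro always_eventually allI)
      show "q n t \<in> {t<..} \<and> q n t \<noteq> t" for n using q[of t n] by auto
    qed
    have lim: "(\<lambda>n. t + 1 / real (Suc n)) \<longlonglongrightarrow> t"
      using LIMSEQ_inverse_real_of_nat_add[of t] by (simp only: inverse_eq_divide)
    show "(\<lambda>n. q n t) \<longlonglongrightarrow> t"
    proof (rule tendsto_sandwich[OF _ _ tendsto_const lim])
      show "\<forall>\<^sub>F n in sequentially. t \<le> q n t" "\<forall>\<^sub>F n in sequentially. q n t \<le> t + 1 / real (Suc n)"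
        using q[of t] by (blast intro: always_eventually less_imp_le)+
    qed
  qed
  show ?thesis
  proof (rule borel_measurable_LIMSEQ_real)
    fix x assume "x \<in> space ((borel :: real measure) \<Otimes>\<^sub>M N)"
    then show "(\<lambda>n. (\<lambda>(t, \<omega>). f (q n t) \<omega>) x) \<longlonglongrightarrow> (\<lambda>(t, \<omega>). f t \<omega>) x"
      by (auto simp: space_pair_measure intro!: filterlim_compose[OF rc qlim])
  next
    fix n
    have "(\<lambda>x. (\<lambda>(t, \<omega>). f ((of_int (g (t * real (Suc n))) + 1) / real (Suc n)) \<omega>) x)
       \<in> borel_measurable (borel \<Otimes>\<^sub>M N)" if "g = floor" for g
    proof -
      have "(\<lambda>x. (\<lambda>i::int. \<lambda>x. f ((of_int i + 1) / real (Suc n)) (snd x)) (g (fst x * real (Suc n))) x)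
         \<in> borel_measurable ((borel :: real measure) \<Otimes>\<^sub>M N)"
      proof (rule measurable_compose_countable[where g="\<lambda>x. g (fst x * real (Suc n))"
            and f="\<lambda>i::int. \<lambda>x. f ((of_int i + 1) / real (Suc n)) (snd x)"])
        show "(\<lambda>x. f ((of_int i + 1) / real (Suc n)) (snd x)) \<in> borel_measurable ((borel :: real measure) \<Otimes>\<^sub>M N)" for i
          by (rule measurable_compose[OF measurable_snd f])
        show "(\<lambda>x. g (fst x * real (Suc n))) \<in> (borel :: real measure) \<Otimes>\<^sub>M N \<rightarrow>\<^sub>M count_space UNIV"
          unfolding that by measurable
      qed
      then show ?thesis by (simp add: case_prod_beta')
    qed
    then show "(\<lambda>(t, \<omega>). f (q n t) \<omega>) \<in> borel_measurable (borel \<Otimes>\<^sub>M N)"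
      unfolding q_def by blast
  qed
qed

section \<open>First passage over a level, and its measurability in level and path\<close>

text \<open>Times at or before the reference time \<open>p\<close> are ignored. An infinite passage time is
  sent to the junk value 0, hence the sets of times considered below exclude 0.\<close>

definition passage :: "real \<Rightarrow> (real \<Rightarrow> real) \<Rightarrow> real \<Rightarrow> real" where
  "passage p F y = real_of_ereal (Inf {ereal t | t. p < t \<and> y < F t})"

text \<open>Expresses the infimum by the values before and after \<open>t\<close>, the value at
  \<open>t\<close> being free. In this form infima over different time ranges can be compared,
  namely that of \<open>crossing_time\<close>, which starts at 0, with that of
  \<open>passage p\<close>.\<close>

lemma Inf_passage_eq_iff:
  fixes F :: "real \<Rightarrow> real"
  assumes mono: "mono_on {p<..} F" and t: "p < t"
  shows "Inf {ereal s | s. p < s \<and> y < F s} = ereal t \<longleftrightarrow>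
    (\<forall>s. p < s \<and> s < t \<longrightarrow> F s \<le> y) \<and> (\<forall>s>t. y < F s)"
proof (intro iffI conjI allI impI)
  assume I: "Inf {ereal s | s. p < s \<and> y < F s} = ereal t"
  fix s assume s: "p < s \<and> s < t"
  show "F s \<le> y"
  proof (rule ccontr)
    assume "\<not> F s \<le> y"
    then have "Inf {ereal s | s. p < s \<and> y < F s} \<le> ereal s" using s by (intro Inf_lower) auto
    then show False using I s by simp
  qed
next
  assume I: "Inf {ereal s | s. p < s \<and> y < F s} = ereal t"
  fix s assume s: "t < s"
  then have "Inf {ereal s | s. p < s \<and> y < F s} < ereal s" using I by simp
  then obtain r where r: "p < r" "y < F r" "r < s" unfolding Inf_less_iff by auto
  then have "F r \<le> F s" using mono s t by (auto simp: mono_on_def)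
  then show "y < F s" using r by simp
next
  assume *: "(\<forall>s. p < s \<and> s < t \<longrightarrow> F s \<le> y) \<and> (\<forall>s>t. y < F s)"
  show "Inf {ereal s | s. p < s \<and> y < F s} = ereal t"
  proof (rule antisym)
    show "Inf {ereal s | s. p < s \<and> y < F s} \<le> ereal t"
    proof (rule dense_ge)
      fix z assume z: "ereal t < z"
      then obtain s where s: "t < s" "ereal s \<le> z"
        using ereal_dense2[OF z] by (auto intro: less_imp_le)
      then have "Inf {ereal s | s. p < s \<and> y < F s} \<le> ereal s"
        using * t by (intro Inf_lower) auto
      then show "Inf {ereal s | s. p < s \<and> y < F s} \<le> z" using s(2) by order
    qed
    show "ereal t \<le> Inf {ereal s | s. p < s \<and> y < F s}"
      using * by (intro Inf_greatest) (auto simp: not_less[symmetric])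
  qed
qed

lemma passage_eqD:
  assumes "passage p F y = t" "t \<noteq> 0"
  shows "Inf {ereal s | s. p < s \<and> y < F s} = ereal t"
  using assms unfolding passage_def
  by (cases "Inf {ereal s | s. p < s \<and> y < F s}") auto

lemma passage_value:
  assumes "strict_mono_on {p<..} F" "p < t"
  shows "passage p F (F t) = t"
proof -
  have "Inf {ereal s | s. p < s \<and> F t < F s} = ereal t"
    using assms by (subst Inf_passage_eq_iff)
      (auto simp: strict_mono_on_imp_mono_on, auto simp: strict_mono_on_def intro: less_imp_le)
  then show ?thesis by (simp add: passage_def)
qed

text \<open>By strict monotonicity \<open>passage p F\<close> is a left inverse of \<open>F\<close>;
  on a flat stretch it would return only the right end. This turns an event about the passage time
  into membership of the level in a set whose length can be computed.\<close>

lemma passage_mem_iff_mem_image: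
  assumes F: "strict_mono_on {p<..} F" and B: "B \<subseteq> {p<..}"
  shows "passage p F y \<in> B \<and> F (passage p F y) = y \<longleftrightarrow> y \<in> F ` B"
proof
  assume "y \<in> F ` B"
  then obtain t where t: "t \<in> B" "y = F t" by blast
  then have "passage p F y = t" using B by (auto intro: passage_value[OF F])
  then show "passage p F y \<in> B \<and> F (passage p F y) = y" using t by simp
qed (auto intro: rev_image_eqI)

text \<open>Time runs over the whole line to avoid side conditions; the processes used later are
  frozen before the reference time by \<open>max p t\<close>.\<close>

locale increasing_process =
  fixes N :: "'a measure" and F :: "real \<Rightarrow> 'a \<Rightarrow> real"
  assumes F_measurable: "\<And>t. F t \<in> borel_measurable N"
    and F_mono: "\<And>\<omega>. \<omega> \<in> space N \<Longrightarrow> mono (\<lambda>t. F t \<omega>)"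
    and F_right_continuous: "\<And>\<omega> t. \<omega> \<in> space N \<Longrightarrow> ((\<lambda>s. F s \<omega>) \<longlongrightarrow> F t \<omega>) (at_right t)"
begin

lemma measurable_pair [measurable]: "(\<lambda>(t, \<omega>). F t \<omega>) \<in> borel_measurable (borel \<Otimes>\<^sub>M N)"
  by (rule measurable_pair_right_continuous[OF F_measurable F_right_continuous])

lemma measurable_passage [measurable]:
  "(\<lambda>(y, \<omega>). passage p (\<lambda>t. F t \<omega>) y) \<in> borel_measurable (borel \<Otimes>\<^sub>M N)"
proof -
  let ?I = "\<lambda>y \<omega>. Inf {ereal t | t. p < t \<and> y < F t \<omega>}"
  have "(\<lambda>(y, \<omega>). ?I y \<omega>) \<in> borel_measurable (borel \<Otimes>\<^sub>M N)"
  proof (rule borel_measurableI_less)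
    fix z :: ereal
    \<comment> \<open>Monotonicity allows a time above the level to be moved right to a rational
      one, which makes the union countable.\<close>
    have "{x \<in> space (borel \<Otimes>\<^sub>M N). (\<lambda>(y, \<omega>). ?I y \<omega>) x < z} =
      (\<Union>r\<in>{r\<in>\<rat>. p < r \<and> ereal r < z}. {x \<in> space (borel \<Otimes>\<^sub>M N). fst x < F r (snd x)})"
    proof (intro equalityI subsetI; clarsimp simp: space_pair_measure)
      fix y \<omega> assume w: "\<omega> \<in> space N" and "?I y \<omega> < z"
      then obtain t where t: "p < t" "y < F t \<omega>" "ereal t < z" unfolding Inf_less_iff by auto
      obtain s where s: "t < s" "ereal s < z"
        using ereal_dense2[OF t(3)] by auto
      obtain r where r: "r \<in> \<rat>" "t < r" "r < s" using Rats_dense_in_real[OF s(1)] by auto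
      have "ereal r < z" using r s by (metis less_ereal.simps(1) less_trans)
      moreover have "y < F r \<omega>" using monoD[OF F_mono[OF w], of t r] t r by auto
      ultimately show "\<exists>r. r \<in> \<rat> \<and> p < r \<and> ereal r < z \<and> y < F r \<omega>" using r t by (intro exI[of _ r]) auto
    next
      fix y \<omega> r assume "r \<in> \<rat>" "p < r" "ereal r < z" "y < F r \<omega>"
      then show "?I y \<omega> < z" unfolding Inf_less_iff by auto
    qed
    also have "\<dots> \<in> sets (borel \<Otimes>\<^sub>M N)"
    proof (rule sets.countable_UN'')
      show "countable {r \<in> \<rat>. p < r \<and> ereal r < z}" by (rule countable_subset[OF _ countable_rat]) auto
      fix r
      have [measurable]: "F r \<in> borel_measurable N" by (rule F_measurable)
      show "{x \<in> space (borel \<Otimes>\<^sub>M N). fst x < F r (snd x)} \<in> sets (borel \<Otimes>\<^sub>M N)" by measurable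
    qed
    finally show "{x \<in> space (borel \<Otimes>\<^sub>M N). (\<lambda>(y, \<omega>). ?I y \<omega>) x < z} \<in> sets (borel \<Otimes>\<^sub>M N)" .
  qed
  then show ?thesis
    unfolding passage_def by (simp add: case_prod_beta')
qed

text \<open>A set of pairs of level and sample point, ready for Fubini. Formulated through
  \<open>passage\<close> and not as the graph of images, because an image of a Borel set has no
  evident measurability.\<close>

definition crossings :: "real \<Rightarrow> real set \<Rightarrow> (real \<times> 'a) set" where
  "crossings p B = {(y, \<omega>). \<omega> \<in> space N \<and> passage p (\<lambda>t. F t \<omega>) y \<in> B \<and> F (passage p (\<lambda>t. F t \<omega>) y) \<omega> = y}"

lemma sets_crossings [measurable]:
  assumes [measurable]: "B \<in> sets borel"
  shows "crossings p B \<in> sets (borel \<Otimes>\<^sub>M N)"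
proof -
  have 1: "(\<lambda>x. passage p (\<lambda>t. F t (snd x)) (fst x)) \<in> borel_measurable (borel \<Otimes>\<^sub>M N)"
    using measurable_passage[of p] by (simp add: case_prod_beta')
  have 2: "(\<lambda>x. F (passage p (\<lambda>t. F t (snd x)) (fst x)) (snd x)) \<in> borel_measurable (borel \<Otimes>\<^sub>M N)"
    using measurable_compose[OF measurable_Pair[OF 1 measurable_snd] measurable_pair] by simp
  have "crossings p B = {x \<in> space (borel \<Otimes>\<^sub>M N). passage p (\<lambda>t. F t (snd x)) (fst x) \<in> B \<and>
      F (passage p (\<lambda>t. F t (snd x)) (fst x)) (snd x) = fst x}"
    by (auto simp: crossings_def space_pair_measure)
  also have "\<dots> \<in> sets (borel \<Otimes>\<^sub>M N)" using 1 2 by measurable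
  finally show ?thesis .
qed

lemma mem_crossings_iff:
  assumes "\<omega> \<in> space N" "strict_mono_on {p<..} (\<lambda>t. F t \<omega>)" "B \<subseteq> {p<..}"
  shows "(y, \<omega>) \<in> crossings p B \<longleftrightarrow> y \<in> (\<lambda>t. F t \<omega>) ` B"
  using passage_mem_iff_mem_image[OF assms(2,3)] assms(1) by (auto simp: crossings_def)

text \<open>The image is the section of \<open>crossings p B\<close> at \<omega>, hence
  Borel.\<close>

lemma sets_image_path:
  assumes w: "\<omega> \<in> space N" "strict_mono_on {p<..} (\<lambda>t. F t \<omega>)" and B: "B \<in> sets borel" "B \<subseteq> {p<..}"
  shows "(\<lambda>t. F t \<omega>) ` B \<in> sets borel"
proof -
  have "(\<lambda>t. F t \<omega>) ` B = (\<lambda>y. (y, \<omega>)) -` crossings p B \<inter> space borel"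
    using mem_crossings_iff[OF w B(2)] by auto
  also have "\<dots> \<in> sets borel"
    using w by (intro measurable_sets[OF _ sets_crossings[OF B(1)]]) auto
  finally show ?thesis .
qed

end

section \<open>Length of the image of an interval: bounds and change of variables\<close>

text \<open>Since \<open>s\<close> and \<open>- c\<close> both increase, an increment of
  \<open>F\<close> dominates that of \<open>c\<close> in absolute value. So \<open>F t\<close>
  determines \<open>c t\<close>, the map between them is nonexpansive, and by the intermediate value
  theorem it reaches every value strictly between \<open>c b\<close> and \<open>c a\<close>.\<close>

lemma emeasure_image_ge_decrease:
  fixes s c :: "real \<Rightarrow> real"
  defines "F \<equiv> \<lambda>t. s t - c t"
  assumes s: "mono s" and c: "antimono c" "continuous_on UNIV c"
    and ab: "a \<le> b" and I: "F ` {a<..b} \<in> sets borel"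
  shows "ennreal (c a - c b) \<le> emeasure lborel (F ` {a<..b})"
proof (rule nonexpansive_image_interval_le)
  have *: "\<bar>c t - c t'\<bar> \<le> \<bar>F t - F t'\<bar>" if "t \<le> t'" for t t'
    using monoD[OF s that] antimonoD[OF c(1) that] by (simp add: F_def)
  have ex: "\<bar>c t - c t'\<bar> \<le> \<bar>F t - F t'\<bar>" for t t'
    using *[of t t'] *[of t' t] by (cases "t \<le> t'") auto
  define f where "f = (\<lambda>y. c (inv_into {a<..b} F y))"
  have f: "f (F t) = c t" if "t \<in> {a<..b}" for t
  proof -
    have "F (inv_into {a<..b} F (F t)) = F t"
      using that by (intro f_inv_into_f imageI)
    then show ?thesis using ex[of "inv_into {a<..b} F (F t)" t] by (simp add: f_def)
  qed
  show "\<bar>f x - f y\<bar> \<le> \<bar>x - y\<bar>" if xy: "x \<in> F ` {a<..b}" "y \<in> F ` {a<..b}" for x y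
  proof -
    obtain t t' where "t \<in> {a<..b}" "x = F t" "t' \<in> {a<..b}" "y = F t'" using xy by blast
    then show ?thesis using ex[of t t'] f[of t] f[of t'] by simp
  qed
  show "{c b<..<c a} \<subseteq> f ` F ` {a<..b}"
  proof
    fix y assume y: "y \<in> {c b<..<c a}"
    have "\<exists>t\<ge>a. t \<le> b \<and> c t = y"
    proof (rule IVT2)
      show "\<forall>x. a \<le> x \<and> x \<le> b \<longrightarrow> isCont c x"
        using c(2) by (simp add: continuous_on_eq_continuous_at)
    qed (use y ab in auto)
    then obtain t where t: "a \<le> t" "t \<le> b" "c t = y" by blast
    moreover have "t \<noteq> a" using t y by auto
    ultimately have "t \<in> {a<..b}" by auto
    then show "y \<in> f ` F ` {a<..b}" using f[of t] t(3) by (metis imageI)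
  qed
  have "F a \<le> F t \<and> F t \<le> F b" if "t \<in> {a<..b}" for t
    using monoD[OF s, of a t] monoD[OF s, of t b] antimonoD[OF c(1), of a t] antimonoD[OF c(1), of t b] that
    by (simp add: F_def)
  then have "F ` {a<..b} \<subseteq> {F a..F b}" by auto
  then show "bounded (F ` {a<..b})" using bounded_closed_interval bounded_subset by metis
qed (rule I)

text \<open>The divisor \<open>Suc n\<close> makes every \<open>n\<close> legitimate: there are
  \<open>Suc n\<close> equal cells, and \<open>b\<close> is the point with index
  \<open>Suc n\<close>.\<close>

definition grid :: "real \<Rightarrow> real \<Rightarrow> nat \<Rightarrow> nat \<Rightarrow> real" where
  "grid a b n i = a + real i * ((b - a) / real (Suc n))"

lemma grid_0 [simp]: "grid a b n 0 = a"
  by (simp add: grid_def)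

lemma grid_end [simp]: "grid a b n (Suc n) = b"
proof -
  have "real (Suc n) * ((b - a) / real (Suc n)) = b - a"
    by (metis nonzero_mult_div_cancel_left of_nat_0_eq_iff old.nat.distinct(2) times_divide_eq_right)
  then show ?thesis by (simp only: grid_def add_diff_eq add_diff_cancel_left')
qed

lemma grid_Suc_diff: "grid a b n (Suc i) - grid a b n i = (b - a) / real (Suc n)"
proof -
  have "a + (1 + r) * h - (a + r * h) = h" for r h :: real
    by (simp add: distrib_right)
  then show ?thesis unfolding grid_def of_nat_Suc[of i] .
qed

lemma grid_less_Suc: "a < b \<Longrightarrow> grid a b n i < grid a b n (Suc i)"
  using grid_Suc_diff[of a b n i] divide_pos_pos[of "b - a" "real (Suc n)"] by linarith

lemma grid_ge: "a \<le> b \<Longrightarrow> a \<le> grid a b n i"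
  by (simp add: grid_def)

lemma grid_cell:
  assumes "a < t" "t \<le> b"
  obtains i where "i < Suc n" "grid a b n i < t" "t \<le> grid a b n (Suc i)"
proof -
  define h where "h = (b - a) / real (Suc n)"
  have h: "0 < h" using assms by (simp add: h_def)
  define x where "x = (t - a) / h"
  have x: "0 < x" "x * h = t - a" using h assms by (auto simp: x_def)
  have "x \<le> real (Suc n)"
    using h assms unfolding x_def pos_divide_le_eq[OF h] by (simp add: h_def del: of_nat_Suc)
  define i where "i = nat (\<lceil>x\<rceil> - 1)"
  have "0 \<le> \<lceil>x\<rceil> - 1" using x by (simp add: int_one_le_iff_zero_less)
  then have i: "real i = of_int \<lceil>x\<rceil> - 1" by (simp add: i_def)
  then have "real i < x" "x \<le> real (Suc i)" by (simp_all, linarith+)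
  then have "real i * h < t - a" "t - a \<le> real (Suc i) * h"
    using mult_strict_right_mono[OF _ h, of "real i" x] mult_right_mono[of x "real (Suc i)" h] h x(2)
    by simp_all
  moreover have "i < Suc n" using \<open>real i < x\<close> \<open>x \<le> real (Suc n)\<close> by linarith
  ultimately show ?thesis
    by (intro that[of i]) (simp_all add: grid_def h_def[symmetric] del: of_nat_Suc)
qed

text \<open>At a continuity point the value is eventually within \<open>d\<close> above the value at
  the left end of its cell, so each cell interval may be cut off at length \<open>d\<close>. Cutting
  discards the gaps left by large jumps. Fatou's lemma then passes to the limit.\<close>

lemma emeasure_image_le_liminf:
  fixes F :: "real \<Rightarrow> real"
  assumes F: "mono F" and ab: "a < b" and d: "0 < d" and I: "F ` {a<..b} \<in> sets borel"
  shows "emeasure lborel (F ` {a<..b}) \<le>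
    liminf (\<lambda>n. \<Sum>i<Suc n. ennreal (min d (F (grid a b n (Suc i)) - F (grid a b n i))))"
proof -
  define K where "K n i = {F (grid a b n i)..min (F (grid a b n (Suc i))) (F (grid a b n i) + d)}" for n i
  define U where "U n = (\<Union>i<Suc n. K n i)" for n
  have [measurable]: "U n \<in> sets borel" for n by (auto simp: U_def K_def)
  note [measurable] = I
  have mg: "F (grid a b n i) \<le> F (grid a b n (Suc i))" for n i
    using grid_less_Suc[OF ab, of n i] by (intro monoD[OF F]) auto
  have mU: "emeasure lborel (U n) \<le> (\<Sum>i<Suc n. ennreal (min d (F (grid a b n (Suc i)) - F (grid a b n i))))" for n
  proof -
    have "emeasure lborel (U n) \<le> (\<Sum>i<Suc n. emeasure lborel (K n i))"
      unfolding U_def by (rule emeasure_subadditive_finite) (auto simp: K_def)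
    also have "\<dots> = (\<Sum>i<Suc n. ennreal (min d (F (grid a b n (Suc i)) - F (grid a b n i))))"
    proof (rule sum.cong[OF refl])
      fix i
      have "F (grid a b n i) \<le> min (F (grid a b n (Suc i))) (F (grid a b n i) + d)"
        using mg d by simp
      then show "emeasure lborel (K n i) = ennreal (min d (F (grid a b n (Suc i)) - F (grid a b n i)))"
        unfolding K_def by (subst emeasure_lborel_Icc) (auto simp: min_def intro!: arg_cong[where f=ennreal])
    qed
    finally show ?thesis .
  qed
  have "countable {t. \<not> isCont F t}" by (rule mono_ctble_discont[OF F])
  \<comment> \<open>The values at discontinuities are removed, not the times: a countable set of
    values is null.\<close>
  then have "AE y in lborel. y \<notin> F ` {t. \<not> isCont F t}"
    by (intro AE_not_in countable_imp_null_set_lborel countable_image)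
  then have "AE y in lborel. indicator (F ` {a<..b}) y \<le> liminf (\<lambda>n. indicator (U n) y :: ennreal)"
  proof eventually_elim
    fix y assume y: "y \<notin> F ` {t. \<not> isCont F t}"
    show "indicator (F ` {a<..b}) y \<le> liminf (\<lambda>n. indicator (U n) y :: ennreal)"
    proof (cases "y \<in> F ` {a<..b}")
      case True
      then obtain t where t: "a < t" "t \<le> b" "y = F t" by auto
      then have "isCont F t" using y by auto
      then obtain r where r: "0 < r" "\<And>s. \<bar>s - t\<bar> < r \<Longrightarrow> \<bar>F s - F t\<bar> < d"
        using d unfolding continuous_at_eps_delta by (auto simp: dist_real_def)
      have "(\<lambda>n. (b - a) / real (Suc n)) \<longlonglongrightarrow> 0"
        using LIMSEQ_Suc[OF lim_const_over_n[of "b - a"]] by simp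
      then have "\<forall>\<^sub>F n in sequentially. (b - a) / real (Suc n) < r"
        using r(1) by (rule order_tendstoD)
      then have "\<forall>\<^sub>F n in sequentially. (1::ennreal) \<le> indicator (U n) y"
      proof eventually_elim
        fix n assume n: "(b - a) / real (Suc n) < r"
        obtain i where i: "i < Suc n" "grid a b n i < t" "t \<le> grid a b n (Suc i)"
          using grid_cell t by blast
        have "\<bar>grid a b n i - t\<bar> < r" using i n grid_Suc_diff[of a b n i] by linarith
        then have "F t \<le> F (grid a b n i) + d" using r(2) by fastforce
        moreover have "F (grid a b n i) \<le> F t" "F t \<le> F (grid a b n (Suc i))"
          using i by (auto intro: monoD[OF F])
        ultimately have "y \<in> K n i" using t by (simp add: K_def)
        then have "y \<in> U n" using i(1) by (auto simp: U_def)
        then show "(1::ennreal) \<le> indicator (U n) y" by simp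
      qed
      then have "(1::ennreal) \<le> liminf (\<lambda>n. indicator (U n) y)" by (rule Liminf_bounded)
      then show ?thesis by (simp add: True)
    qed simp
  qed
  then have "(\<integral>\<^sup>+y. indicator (F ` {a<..b}) y \<partial>lborel) \<le> (\<integral>\<^sup>+y. liminf (\<lambda>n. indicator (U n) y) \<partial>lborel)"
    by (rule nn_integral_mono_AE)
  also have "\<dots> \<le> liminf (\<lambda>n. \<integral>\<^sup>+y. indicator (U n) y \<partial>lborel)"
    by (rule nn_integral_liminf) measurable
  also have "\<dots> \<le> liminf (\<lambda>n. \<Sum>i<Suc n. ennreal (min d (F (grid a b n (Suc i)) - F (grid a b n i))))"
    using mU by (intro Liminf_mono always_eventually) simp
  finally show ?thesis using I by simp
qed

text \<open>Lebesgue measure on the image, pushed forward by the passage map, and the measure with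
  density \<open>k\<close> agree on all half-lines, by the hypothesis on intervals. They are finite
  there, hence equal, and integrals are transported along this equality.\<close>

lemma nn_integral_image_change_of_variables:
  fixes F :: "real \<Rightarrow> real" and k f :: "real \<Rightarrow> ennreal"
  assumes F: "strict_mono_on {p<..} F" and p: "p < al" "al \<le> be"
    and img: "\<And>B. B \<in> sets borel \<Longrightarrow> B \<subseteq> {p<..} \<Longrightarrow> F ` B \<in> sets borel"
    and [measurable]: "passage p F \<in> borel_measurable borel" "F \<in> borel_measurable borel"
      "k \<in> borel_measurable borel" "f \<in> borel_measurable borel"
    and k: "\<And>a b. al \<le> a \<Longrightarrow> a \<le> b \<Longrightarrow> b \<le> be \<Longrightarrow>
        emeasure lborel (F ` {a<..b}) = (\<integral>\<^sup>+t. k t * indicator {a<..b} t \<partial>lborel)"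
    and fin: "emeasure lborel (F ` {al<..be}) < \<infinity>"
    and B[measurable]: "B \<in> sets borel" and Bsub: "B \<subseteq> {al<..be}"
  shows "(\<integral>\<^sup>+y. f y * indicator (F ` B) y \<partial>lborel) = (\<integral>\<^sup>+t. f (F t) * k t * indicator B t \<partial>lborel)"
proof -
  define I where "I = F ` {al<..be}"
  have [measurable]: "I \<in> sets borel" using p by (auto simp: I_def intro!: img)
  have pas: "passage p F (F t) = t" if "al < t" for t
    using that p by (intro passage_value[OF F]) auto
  define Q where "Q = distr (density lborel (indicator I)) borel (passage p F)"
  define R where "R = density lborel (\<lambda>t. k t * indicator {al<..be} t)"
  have QR: "emeasure Q {x<..} = emeasure R {x<..}" "emeasure Q {x<..} < \<infinity>" for x
  proof -
    \<comment> \<open>The end point \<open>x\<close> clamped to the interval, so that the part of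
      the half-line inside it is \<open>{a<..be}\<close>, possibly empty.\<close>
    define a where "a = min be (max x al)"
    have a: "al \<le> a" "a \<le> be" using p by (auto simp: a_def)
    have [measurable]: "passage p F -` {x<..} \<in> sets borel"
      by (rule measurable_sets_borel) measurable
    have "emeasure Q {x<..} = (\<integral>\<^sup>+y. indicator I y * indicator (passage p F -` {x<..}) y \<partial>lborel)"
      by (simp add: Q_def emeasure_distr emeasure_density)
    also have "\<dots> = emeasure lborel (I \<inter> passage p F -` {x<..})"
      by (simp add: indicator_inter_arith[symmetric])
    also have "I \<inter> passage p F -` {x<..} = F ` {a<..be}"
      by (auto simp: I_def a_def pas)
    finally have Q_eq: "emeasure Q {x<..} = emeasure lborel (F ` {a<..be})" .
    also have "\<dots> = (\<integral>\<^sup>+t. k t * indicator {a<..be} t \<partial>lborel)"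
      using a by (intro k) auto
    also have "\<dots> = emeasure R {x<..}"
      by (auto simp: R_def emeasure_density a_def intro!: nn_integral_cong split: split_indicator)
    finally show "emeasure Q {x<..} = emeasure R {x<..}" .
    have "emeasure Q {x<..} = emeasure lborel (F ` {a<..be})" by (rule Q_eq)
    also have "\<dots> \<le> emeasure lborel I"
    proof (rule emeasure_mono)
      show "F ` {a<..be} \<subseteq> I" using a by (auto simp: I_def)
    qed simp
    finally show "emeasure Q {x<..} < \<infinity>" using fin by (simp add: I_def)
  qed
  have "Q = R"
  proof (rule measure_eqI_lessThan)
    show "sets Q = sets borel" "sets R = sets borel" by (simp_all add: Q_def R_def)
  qed (rule QR)+
  have "(\<integral>\<^sup>+y. f y * indicator (F ` B) y \<partial>lborel) =
      (\<integral>\<^sup>+y. indicator I y * (f (F (passage p F y)) * indicator B (passage p F y)) \<partial>lborel)"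
  proof (rule nn_integral_cong)
    fix y
    show "f y * indicator (F ` B) y = indicator I y * (f (F (passage p F y)) * indicator B (passage p F y))"
    proof (cases "y \<in> I")
      case True
      then obtain t where t: "t \<in> {al<..be}" "y = F t" by (auto simp: I_def)
      have "F t \<in> F ` B \<longleftrightarrow> t \<in> B"
        using t Bsub pas by (metis greaterThanAtMost_iff imageE image_eqI subsetD)
      then show ?thesis using True t pas[of t] by (auto simp: indicator_def)
    next
      case False
      then have "y \<notin> F ` B" using Bsub by (auto simp: I_def)
      then show ?thesis using False by simp
    qed
  qed
  also have "\<dots> = (\<integral>\<^sup>+t. f (F t) * indicator B t \<partial>Q)"
    unfolding Q_def by (subst nn_integral_distr, measurable, subst nn_integral_density, measurable)
  also have "\<dots> = (\<integral>\<^sup>+t. k t * indicator {al<..be} t * (f (F t) * indicator B t) \<partial>lborel)"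
    unfolding \<open>Q = R\<close> R_def by (subst nn_integral_density) measurable
  also have "\<dots> = (\<integral>\<^sup>+t. f (F t) * k t * indicator B t \<partial>lborel)"
    using Bsub by (intro nn_integral_cong) (auto split: split_indicator simp: ac_simps)
  finally show ?thesis .
qed

lemma (in prob_space) AE_eq_const_if_nn_integral_le:
  assumes [measurable]: "f \<in> borel_measurable M" and ge: "AE x in M. ennreal K \<le> f x"
    and le: "(\<integral>\<^sup>+x. f x \<partial>M) \<le> ennreal K"
  shows "AE x in M. f x = ennreal K"
proof -
  have "(\<integral>\<^sup>+x. f x - ennreal K \<partial>M) = (\<integral>\<^sup>+x. f x \<partial>M) - (\<integral>\<^sup>+x. ennreal K \<partial>M)"
    using ge by (intro nn_integral_diff) (auto simp: emeasure_space_1)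
  also have "\<dots> = 0"
    using le le_less_trans[OF le ennreal_less_top] by (simp add: emeasure_space_1 diff_eq_0_ennreal)
  finally have "AE x in M. f x - ennreal K = 0"
    by (subst (asm) nn_integral_0_iff_AE) auto
  with ge show ?thesis
    by eventually_elim (auto simp: diff_eq_0_iff_ennreal)
qed

section \<open>Strictly increasing paths against a decreasing boundary\<close>

text \<open>The assumption \<open>small_increments\<close> encodes the absence of drift: under a
  drift delta the integral is at least min d (delta * (t - s)), which contradicts the bound with
  \<open>e\<close> below delta as soon as \<open>t - s\<close> is small.\<close>

locale boundary_crossing = prob_space N for N :: "'a measure" +
  fixes Y :: "real \<Rightarrow> 'a \<Rightarrow> real" and c :: "real \<Rightarrow> real" and p :: real
  assumes Y_measurable: "\<And>t. Y t \<in> borel_measurable N"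
    and Y_mono: "\<And>\<omega>. \<omega> \<in> space N \<Longrightarrow> mono (\<lambda>t. Y t \<omega>)"
    and Y_right_continuous: "\<And>\<omega> t. \<omega> \<in> space N \<Longrightarrow> ((\<lambda>s. Y s \<omega>) \<longlongrightarrow> Y t \<omega>) (at_right t)"
    and AE_Y_strict_mono: "AE \<omega> in N. strict_mono_on {p<..} (\<lambda>t. Y t \<omega>)"
    and small_increments: "\<And>e. 0 < e \<Longrightarrow> \<exists>d>0. \<forall>s t. p \<le> s \<longrightarrow> s < t \<longrightarrow>
          (\<integral>\<^sup>+\<omega>. ennreal (min d (Y t \<omega> - Y s \<omega>)) \<partial>N) \<le> ennreal (e * (t - s))"
    and c_continuous: "continuous_on UNIV c"
    and c_antimono: "antimono c"
begin

sublocale increasing_process N "\<lambda>t \<omega>. Y t \<omega> - c t"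
proof
  fix \<omega> t assume "\<omega> \<in> space N"
  then show "((\<lambda>s. Y s \<omega> - c s) \<longlongrightarrow> Y t \<omega> - c t) (at_right t)"
    using c_continuous
    by (intro tendsto_diff Y_right_continuous)
      (auto simp: continuous_on_def intro: filterlim_mono[OF _ order_refl at_le])
next
  fix \<omega> assume "\<omega> \<in> space N"
  then show "mono (\<lambda>t. Y t \<omega> - c t)"
    using Y_mono[of \<omega>] c_antimono by (auto simp: mono_def antimono_def intro: diff_mono)
qed (use Y_measurable in measurable)

sublocale P: pair_sigma_finite lborel N ..

abbreviation path :: "'a \<Rightarrow> real \<Rightarrow> real" where
  "path \<omega> \<equiv> \<lambda>t. Y t \<omega> - c t"

lemma AE_path_strict_mono: "AE \<omega> in N. strict_mono_on {p<..} (path \<omega>)"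
  using AE_Y_strict_mono
proof eventually_elim
  fix \<omega> assume *: "strict_mono_on {p<..} (\<lambda>t. Y t \<omega>)"
  show "strict_mono_on {p<..} (path \<omega>)"
  proof (rule strict_mono_onI)
    fix r s assume "r \<in> {p<..}" "s \<in> {p<..}" "r < s"
    then have "Y r \<omega> < Y s \<omega>" "c s \<le> c r"
      using strict_mono_onD[OF *] antimonoD[OF c_antimono, of r s] by auto
    then show "Y r \<omega> - c r < Y s \<omega> - c s" by simp
  qed
qed

text \<open>Defined as the length of a section, so that it is measurable in \<omega> also where the
  path fails to be strictly increasing.\<close>

definition image_length :: "real set \<Rightarrow> 'a \<Rightarrow> ennreal" where
  "image_length B \<omega> = emeasure lborel ((\<lambda>y. (y, \<omega>)) -` crossings p B)"

lemma image_length_measurable [measurable]: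
  assumes "B \<in> sets borel"
  shows "image_length B \<in> borel_measurable N"
proof -
  have "crossings p B \<in> sets (lborel \<Otimes>\<^sub>M N)"
    using sets_crossings[OF assms] by (simp cong: sets_pair_measure_cong)
  then show ?thesis
    unfolding image_length_def by (rule P.measurable_emeasure_Pair2)
qed

lemma image_length_eq:
  assumes "\<omega> \<in> space N" "strict_mono_on {p<..} (path \<omega>)" "B \<subseteq> {p<..}"
  shows "image_length B \<omega> = emeasure lborel (path \<omega> ` B)"
proof -
  have "(\<lambda>y. (y, \<omega>)) -` crossings p B = path \<omega> ` B"
    using mem_crossings_iff[OF assms] by auto
  then show ?thesis by (simp add: image_length_def)
qed

text \<open>On each grid cell the expected truncated increment of the path is at most
  \<open>e\<close> times the mesh plus the fall of \<open>c\<close>. The sum telescopes to the fall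
  of \<open>c\<close> over the whole interval plus \<open>e * (b - a)\<close>, uniformly in the
  grid.\<close>

lemma expected_image_length_le:
  assumes a: "p \<le> a" "a < b"
  shows "(\<integral>\<^sup>+\<omega>. image_length {a<..b} \<omega> \<partial>N) \<le> ennreal (c a - c b)"
proof (rule ennreal_le_epsilon)
  fix e' :: real assume "0 < e'"
  define e where "e = e' / (b - a)"
  have e: "0 < e" "e * (b - a) = e'" using \<open>0 < e'\<close> a by (auto simp: e_def)
  obtain d where d: "0 < d" "\<And>s t. p \<le> s \<Longrightarrow> s < t \<Longrightarrow>
      (\<integral>\<^sup>+\<omega>. ennreal (min d (Y t \<omega> - Y s \<omega>)) \<partial>N) \<le> ennreal (e * (t - s))"
    using small_increments[OF e(1)] by blast
  let ?g = "grid a b"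
  note [measurable] = Y_measurable
  have cell: "(\<integral>\<^sup>+\<omega>. ennreal (min d (path \<omega> (?g n (Suc i)) - path \<omega> (?g n i))) \<partial>N)
      \<le> ennreal (e * (?g n (Suc i) - ?g n i) + (c (?g n i) - c (?g n (Suc i))))" for n i
  proof -
    have g: "p \<le> ?g n i" "?g n i < ?g n (Suc i)"
      using a grid_ge[of a b n i] grid_less_Suc[of a b n i] by auto
    then have dc: "0 \<le> c (?g n i) - c (?g n (Suc i))"
      using antimonoD[OF c_antimono, of "?g n i" "?g n (Suc i)"] by simp
    \<comment> \<open>The path increment is the increment of \<open>Y\<close> plus the nonnegative
      fall of \<open>c\<close>; only the former needs the truncation.\<close>
    have "(\<integral>\<^sup>+\<omega>. ennreal (min d (path \<omega> (?g n (Suc i)) - path \<omega> (?g n i))) \<partial>N) \<le>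
      (\<integral>\<^sup>+\<omega>. ennreal (min d (Y (?g n (Suc i)) \<omega> - Y (?g n i) \<omega>)) + ennreal (c (?g n i) - c (?g n (Suc i))) \<partial>N)"
    proof (rule nn_integral_mono)
      fix \<omega> assume "\<omega> \<in> space N"
      then have "0 \<le> Y (?g n (Suc i)) \<omega> - Y (?g n i) \<omega>"
        using monoD[OF Y_mono, of \<omega> "?g n i" "?g n (Suc i)"] g by simp
      then have plus: "ennreal (min d (Y (?g n (Suc i)) \<omega> - Y (?g n i) \<omega>) + (c (?g n i) - c (?g n (Suc i)))) =
          ennreal (min d (Y (?g n (Suc i)) \<omega> - Y (?g n i) \<omega>)) + ennreal (c (?g n i) - c (?g n (Suc i)))"
        using dc d(1) by (intro ennreal_plus) auto
      show "ennreal (min d (path \<omega> (?g n (Suc i)) - path \<omega> (?g n i))) \<le>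
          ennreal (min d (Y (?g n (Suc i)) \<omega> - Y (?g n i) \<omega>)) + ennreal (c (?g n i) - c (?g n (Suc i)))"
        unfolding plus[symmetric] using dc by (intro ennreal_leI) (simp add: min_def)
    qed
    also have "\<dots> = (\<integral>\<^sup>+\<omega>. ennreal (min d (Y (?g n (Suc i)) \<omega> - Y (?g n i) \<omega>)) \<partial>N) +
        ennreal (c (?g n i) - c (?g n (Suc i)))"
      by (subst nn_integral_add) (auto simp: emeasure_space_1)
    also have "\<dots> \<le> ennreal (e * (?g n (Suc i) - ?g n i)) + ennreal (c (?g n i) - c (?g n (Suc i)))"
      using g by (intro add_right_mono d)
    also have "\<dots> = ennreal (e * (?g n (Suc i) - ?g n i) + (c (?g n i) - c (?g n (Suc i))))"
      using dc e(1) g by (intro ennreal_plus[symmetric]) auto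
    finally show ?thesis .
  qed
  have total: "(\<Sum>i<Suc n. ennreal (e * (?g n (Suc i) - ?g n i) + (c (?g n i) - c (?g n (Suc i)))))
      = ennreal (c a - c b) + ennreal e'" for n
  proof -
    have "(\<Sum>i<Suc n. ennreal (e * (?g n (Suc i) - ?g n i) + (c (?g n i) - c (?g n (Suc i)))))
        = ennreal (\<Sum>i<Suc n. e * (?g n (Suc i) - ?g n i) + (c (?g n i) - c (?g n (Suc i))))"
    proof (rule sum_ennreal)
      fix i
      have "?g n i < ?g n (Suc i)" using a grid_less_Suc by auto
      then show "0 \<le> e * (?g n (Suc i) - ?g n i) + (c (?g n i) - c (?g n (Suc i)))"
        using e(1) antimonoD[OF c_antimono, of "?g n i" "?g n (Suc i)"] by simp
    qed
    also have "(\<Sum>i<Suc n. e * (?g n (Suc i) - ?g n i) + (c (?g n i) - c (?g n (Suc i))))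
        = e * (\<Sum>i<Suc n. ?g n (Suc i) - ?g n i) + (\<Sum>i<Suc n. c (?g n i) - c (?g n (Suc i)))"
      by (simp only: sum.distrib sum_distrib_left)
    also have "\<dots> = (c a - c b) + e'"
      using sum_lessThan_telescope[of "?g n" "Suc n"] sum_lessThan_telescope'[of "\<lambda>i. c (?g n i)" "Suc n"]
      by (simp only: grid_0 grid_end e(2) add.commute)
    also have "ennreal \<dots> = ennreal (c a - c b) + ennreal e'"
      using a antimonoD[OF c_antimono, of a b] \<open>0 < e'\<close> by (intro ennreal_plus) auto
    finally show ?thesis .
  qed
  have "(\<integral>\<^sup>+\<omega>. image_length {a<..b} \<omega> \<partial>N) \<le>
      (\<integral>\<^sup>+\<omega>. liminf (\<lambda>n. \<Sum>i<Suc n. ennreal (min d (path \<omega> (?g n (Suc i)) - path \<omega> (?g n i)))) \<partial>N)"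
  proof (rule nn_integral_mono_AE)
    show "AE \<omega> in N. image_length {a<..b} \<omega> \<le>
      liminf (\<lambda>n. \<Sum>i<Suc n. ennreal (min d (path \<omega> (?g n (Suc i)) - path \<omega> (?g n i))))"
      using AE_path_strict_mono AE_space
    proof eventually_elim
      fix \<omega> assume w: "strict_mono_on {p<..} (path \<omega>)" "\<omega> \<in> space N"
      have sub: "{a<..b} \<subseteq> {p<..}" using a by auto
      show "image_length {a<..b} \<omega> \<le>
        liminf (\<lambda>n. \<Sum>i<Suc n. ennreal (min d (path \<omega> (?g n (Suc i)) - path \<omega> (?g n i))))"
        unfolding image_length_eq[OF w(2,1) sub]
        using w sub by (intro emeasure_image_le_liminf F_mono a d sets_image_path) auto
    qed
  qed
  also have "\<dots> \<le> liminf (\<lambda>n. \<integral>\<^sup>+\<omega>. (\<Sum>i<Suc n. ennreal (min d (path \<omega> (?g n (Suc i)) - path \<omega> (?g n i)))) \<partial>N)"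
    by (rule nn_integral_liminf) measurable
  also have "\<dots> \<le> liminf (\<lambda>n. ennreal (c a - c b) + ennreal e')"
  proof (intro Liminf_mono always_eventually allI)
    fix n
    have "(\<integral>\<^sup>+\<omega>. (\<Sum>i<Suc n. ennreal (min d (path \<omega> (?g n (Suc i)) - path \<omega> (?g n i)))) \<partial>N)
      = (\<Sum>i<Suc n. \<integral>\<^sup>+\<omega>. ennreal (min d (path \<omega> (?g n (Suc i)) - path \<omega> (?g n i))) \<partial>N)"
      by (rule nn_integral_sum) measurable
    also have "\<dots> \<le> (\<Sum>i<Suc n. ennreal (e * (?g n (Suc i) - ?g n i) + (c (?g n i) - c (?g n (Suc i)))))"
      by (intro sum_mono cell)
    also note total
    finally show "(\<integral>\<^sup>+\<omega>. (\<Sum>i<Suc n. ennreal (min d (path \<omega> (?g n (Suc i)) - path \<omega> (?g n i)))) \<partial>N)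
      \<le> ennreal (c a - c b) + ennreal e'" .
  qed
  also have "\<dots> = ennreal (c a - c b) + ennreal e'"
    by (simp add: Liminf_const)
  finally show "(\<integral>\<^sup>+\<omega>. image_length {a<..b} \<omega> \<partial>N) \<le> ennreal (c a - c b) + ennreal e'" .
qed

lemma image_length_ge:
  assumes "\<omega> \<in> space N" "strict_mono_on {p<..} (path \<omega>)" "p \<le> a" "a \<le> b"
  shows "ennreal (c a - c b) \<le> emeasure lborel (path \<omega> ` {a<..b})"
  using assms
  by (intro emeasure_image_ge_decrease Y_mono c_antimono c_continuous sets_image_path) auto

text \<open>A random variable bounded below by a constant, with mean at most that constant, equals
  it almost surely. This settles all rational end points at once; the pathwise lower bound and the
  continuity of \<open>c\<close> extend the equality to real ones on a single event.\<close>

lemma AE_image_length: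
  "AE \<omega> in N. \<forall>a b. p < a \<longrightarrow> a \<le> b \<longrightarrow> emeasure lborel (path \<omega> ` {a<..b}) = ennreal (c a - c b)"
proof -
  have "AE \<omega> in N. \<forall>a\<in>\<rat>. \<forall>b\<in>\<rat>. p < a \<longrightarrow> a < b \<longrightarrow> image_length {a<..b} \<omega> = ennreal (c a - c b)"
  proof (intro AE_ball_countable[THEN iffD2] ballI countable_rat AE_impI)
    fix a b :: real assume ab: "p < a" "a < b"
    show "AE \<omega> in N. image_length {a<..b} \<omega> = ennreal (c a - c b)"
    proof (rule AE_eq_const_if_nn_integral_le)
      show "AE \<omega> in N. ennreal (c a - c b) \<le> image_length {a<..b} \<omega>"
        using AE_path_strict_mono AE_space
      proof eventually_elim
        fix \<omega> assume w: "strict_mono_on {p<..} (path \<omega>)" "\<omega> \<in> space N"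
        have "{a<..b} \<subseteq> {p<..}" using ab by auto
        then show "ennreal (c a - c b) \<le> image_length {a<..b} \<omega>"
          using image_length_ge[OF w(2,1), of a b] image_length_eq[OF w(2,1), of "{a<..b}"] ab by simp
      qed
    qed (use ab expected_image_length_le in auto)
  qed
  with AE_path_strict_mono AE_space show ?thesis
  proof eventually_elim
    fix \<omega> assume w: "strict_mono_on {p<..} (path \<omega>)" "\<omega> \<in> space N"
      and eq: "\<forall>a\<in>\<rat>. \<forall>b\<in>\<rat>. p < a \<longrightarrow> a < b \<longrightarrow> image_length {a<..b} \<omega> = ennreal (c a - c b)"
    show "\<forall>a b. p < a \<longrightarrow> a \<le> b \<longrightarrow> emeasure lborel (path \<omega> ` {a<..b}) = ennreal (c a - c b)"
    proof (intro allI impI antisym)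
      fix a b assume ab: "p < a" "a \<le> b"
      then show "ennreal (c a - c b) \<le> emeasure lborel (path \<omega> ` {a<..b})"
        by (intro image_length_ge w) auto
      show "emeasure lborel (path \<omega> ` {a<..b}) \<le> ennreal (c a - c b)"
      proof (rule ennreal_le_epsilon)
        fix e :: real assume e: "0 < e"
        have cont: "\<exists>r>0. \<forall>s. \<bar>s - t\<bar> < r \<longrightarrow> \<bar>c s - c t\<bar> < e / 2" for t
          using c_continuous e unfolding continuous_on_iff
          by (metis UNIV_I dist_real_def half_gt_zero)
        obtain r1 where r1: "0 < r1" "\<And>s. \<bar>s - a\<bar> < r1 \<Longrightarrow> \<bar>c s - c a\<bar> < e / 2" using cont[of a] by blast
        obtain r2 where r2: "0 < r2" "\<And>s. \<bar>s - b\<bar> < r2 \<Longrightarrow> \<bar>c s - c b\<bar> < e / 2" using cont[of b] by blast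
        \<comment> \<open>The interval is enlarged to rational end points, since only the upper
          bound is still missing; \<open>a'\<close> has to stay above \<open>p\<close>.\<close>
        obtain a' where a': "a' \<in> \<rat>" "max p (a - r1) < a'" "a' < a"
          using Rats_dense_in_real[of "max p (a - r1)" a] ab r1(1) by auto
        obtain b' where b': "b' \<in> \<rat>" "b < b'" "b' < b + r2"
          using Rats_dense_in_real[of b "b + r2"] r2(1) by auto
        have ca: "c a' \<le> c a + e / 2" "c b \<le> c b' + e / 2"
        proof -
          have "\<bar>c a' - c a\<bar> < e / 2" by (rule r1(2)) (use a' in auto)
          moreover have "\<bar>c b' - c b\<bar> < e / 2" by (rule r2(2)) (use b' in auto)
          ultimately show "c a' \<le> c a + e / 2" "c b \<le> c b' + e / 2" by linarith+
        qed
        have sub: "{a'<..b'} \<subseteq> {p<..}" using a' by auto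
        have "emeasure lborel (path \<omega> ` {a<..b}) \<le> emeasure lborel (path \<omega> ` {a'<..b'})"
        proof (rule emeasure_mono)
          show "path \<omega> ` {a<..b} \<subseteq> path \<omega> ` {a'<..b'}" using a' b' by (intro image_mono) auto
          show "path \<omega> ` {a'<..b'} \<in> sets lborel" using sub w by (simp add: sets_image_path)
        qed
        also have "\<dots> = ennreal (c a' - c b')"
          using eq a' b' ab unfolding image_length_eq[OF w(2,1) sub, symmetric] by auto
        also have "\<dots> \<le> ennreal ((c a - c b) + e)" using ca by (intro ennreal_leI) auto
        also have "\<dots> = ennreal (c a - c b) + ennreal e"
          using antimonoD[OF c_antimono ab(2)] e by (intro ennreal_plus) auto
        finally show "emeasure lborel (path \<omega> ` {a<..b}) \<le> ennreal (c a - c b) + ennreal e" .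
      qed
    qed
  qed
qed

text \<open>The change of variables on almost every path, followed by Fubini. The left side is the
  probability of a crossing in \<open>B\<close> when an independent level has density
  \<open>f\<close>.\<close>

lemma nn_integral_crossings:
  fixes k f :: "real \<Rightarrow> ennreal"
  assumes p: "p < al" "al \<le> be"
    and [measurable]: "k \<in> borel_measurable borel" "f \<in> borel_measurable borel"
    and k: "\<And>a b. al \<le> a \<Longrightarrow> a \<le> b \<Longrightarrow> b \<le> be \<Longrightarrow>
        (\<integral>\<^sup>+t. k t * indicator {a<..b} t \<partial>lborel) = ennreal (c a - c b)"
    and B[measurable]: "B \<in> sets borel" and Bsub: "B \<subseteq> {al<..be}"
  shows "(\<integral>\<^sup>+\<omega>. \<integral>\<^sup>+y. f y * indicator (crossings p B) (y, \<omega>) \<partial>lborel \<partial>N) =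
    (\<integral>\<^sup>+t. (\<integral>\<^sup>+\<omega>. f (Y t \<omega> - c t) \<partial>N) * k t * indicator B t \<partial>lborel)"
proof -
  have meas: "(\<lambda>x. Y (fst x) (snd x) - c (fst x)) \<in> borel_measurable (lborel \<Otimes>\<^sub>M N)"
    using measurable_pair by (simp add: case_prod_beta' cong: measurable_cong_sets sets_pair_measure_cong)
  have "(\<integral>\<^sup>+\<omega>. \<integral>\<^sup>+y. f y * indicator (crossings p B) (y, \<omega>) \<partial>lborel \<partial>N) =
    (\<integral>\<^sup>+\<omega>. \<integral>\<^sup>+t. f (Y t \<omega> - c t) * k t * indicator B t \<partial>lborel \<partial>N)"
  proof (rule nn_integral_cong_AE)
    show "AE \<omega> in N. (\<integral>\<^sup>+y. f y * indicator (crossings p B) (y, \<omega>) \<partial>lborel) =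
       (\<integral>\<^sup>+t. f (Y t \<omega> - c t) * k t * indicator B t \<partial>lborel)"
      using AE_path_strict_mono AE_space AE_image_length
    proof eventually_elim
      fix \<omega> assume w: "strict_mono_on {p<..} (path \<omega>)" "\<omega> \<in> space N"
       and len: "\<forall>a b. p < a \<longrightarrow> a \<le> b \<longrightarrow> emeasure lborel (path \<omega> ` {a<..b}) = ennreal (c a - c b)"
      have "B \<subseteq> {p<..}" using Bsub p by auto
      then have "(\<integral>\<^sup>+y. f y * indicator (crossings p B) (y, \<omega>) \<partial>lborel) =
        (\<integral>\<^sup>+y. f y * indicator (path \<omega> ` B) y \<partial>lborel)"
        using mem_crossings_iff[OF w(2,1)] by (intro nn_integral_cong) (simp add: indicator_def)
      also have "\<dots> = (\<integral>\<^sup>+t. f (path \<omega> t) * k t * indicator B t \<partial>lborel)"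
      proof (rule nn_integral_image_change_of_variables[OF w(1) p])
        show "passage p (path \<omega>) \<in> borel_measurable borel"
          using measurable_compose[OF measurable_Pair2'[OF w(2)] measurable_passage[of p]] by simp
        show "path \<omega> \<in> borel_measurable borel"
          by (rule borel_measurable_mono) (rule F_mono[OF w(2)])
        show "emeasure lborel (path \<omega> ` {al<..be}) < \<infinity>" using len p by simp
        show "emeasure lborel (path \<omega> ` {a<..b}) = (\<integral>\<^sup>+t. k t * indicator {a<..b} t \<partial>lborel)"
          if "al \<le> a" "a \<le> b" "b \<le> be" for a b
          using len k[OF that] that p by simp
      qed (use w Bsub in \<open>auto intro: sets_image_path\<close>)
      finally show "(\<integral>\<^sup>+y. f y * indicator (crossings p B) (y, \<omega>) \<partial>lborel) =
        (\<integral>\<^sup>+t. f (Y t \<omega> - c t) * k t * indicator B t \<partial>lborel)" .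
    qed
  qed
  also have "\<dots> = (\<integral>\<^sup>+t. \<integral>\<^sup>+\<omega>. f (Y t \<omega> - c t) * k t * indicator B t \<partial>N \<partial>lborel)"
  proof (rule P.Fubini')
    show "(\<lambda>(t, \<omega>). f (Y t \<omega> - c t) * k t * indicator B t) \<in> borel_measurable (lborel \<Otimes>\<^sub>M N)"
      using measurable_compose[OF meas, of f] by (simp add: case_prod_beta')
  qed
  also have "\<dots> = (\<integral>\<^sup>+t. (\<integral>\<^sup>+\<omega>. f (Y t \<omega> - c t) \<partial>N) * k t * indicator B t \<partial>lborel)"
  proof (rule nn_integral_cong)
    fix t
    note [measurable] = Y_measurable
    show "(\<integral>\<^sup>+\<omega>. f (Y t \<omega> - c t) * k t * indicator B t \<partial>N) = (\<integral>\<^sup>+\<omega>. f (Y t \<omega> - c t) \<partial>N) * k t * indicator B t"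
      unfolding mult.assoc by (rule nn_integral_multc) measurable
  qed
  finally show ?thesis .
qed

end

section \<open>Independence of the past and the restarted process\<close>

context levy_process
begin

text \<open>The maximum freezes the process at 0 up to time \<open>p\<close>, which gives paths on
  the whole line.\<close>

definition restarted :: "real \<Rightarrow> real \<Rightarrow> 'a \<Rightarrow> real" where
  "restarted p t \<omega> = S (max p t) \<omega> - S p \<omega>"

definition restarted_cylinders :: "real \<Rightarrow> 'a set set" where
  "restarted_cylinders p =
    {{\<omega> \<in> space M. \<forall>t\<in>I. restarted p t \<omega> \<in> A t} | I A. finite I \<and> (\<forall>t. A t \<in> sets borel)}"

text \<open>Carries the \<open>\<sigma>\<close>-algebra generated by the process restarted at time \<open>p\<close>; its measure is
  irrelevant.\<close>

definition future :: "real \<Rightarrow> 'a measure" where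
  "future p = sigma (space M) (restarted_cylinders p)"

lemma restarted_measurable_M: "0 \<le> p \<Longrightarrow> restarted p t \<in> borel_measurable M"
  unfolding restarted_def[abs_def] by (intro borel_measurable_diff random_variable_at) auto

lemma restarted_cylinders_subset: "0 \<le> p \<Longrightarrow> restarted_cylinders p \<subseteq> events"
proof
  fix E assume p: "0 \<le> p" and "E \<in> restarted_cylinders p"
  then obtain I A where E: "E = {\<omega> \<in> space M. \<forall>t\<in>I. restarted p t \<omega> \<in> A t}"
    "finite I" "\<And>t. A t \<in> sets borel" unfolding restarted_cylinders_def by blast
  have "{\<omega> \<in> space M. restarted p t \<omega> \<in> A t} \<in> events" for t
    using measurable_sets[OF restarted_measurable_M[OF p, of t] E(3)[of t]]
    by (simp add: vimage_def Int_def conj_commute)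
  then show "E \<in> events"
    unfolding E(1) by (intro sets.sets_Collect_finite_All E(2))
qed

lemma Int_stable_restarted_cylinders: "Int_stable (restarted_cylinders p)"
proof (rule Int_stableI)
  fix E E' assume "E \<in> restarted_cylinders p" "E' \<in> restarted_cylinders p"
  then obtain I A I' A' where
    E: "E = {\<omega> \<in> space M. \<forall>t\<in>I. restarted p t \<omega> \<in> A t}" "finite I" "\<And>t. A t \<in> sets borel" and
    E': "E' = {\<omega> \<in> space M. \<forall>t\<in>I'. restarted p t \<omega> \<in> A' t}" "finite I'" "\<And>t. A' t \<in> sets borel"
    unfolding restarted_cylinders_def by blast
  define A'' where "A'' t = (if t \<in> I then A t else UNIV) \<inter> (if t \<in> I' then A' t else UNIV)" for t
  have "E \<inter> E' = {\<omega> \<in> space M. \<forall>t\<in>I \<union> I'. restarted p t \<omega> \<in> A'' t}"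
    unfolding E E' A''_def by auto
  moreover have "finite (I \<union> I')" "\<forall>t. A'' t \<in> sets borel" using E E' by (auto simp: A''_def)
  ultimately show "E \<inter> E' \<in> restarted_cylinders p"
    unfolding restarted_cylinders_def by blast
qed

lemma space_future [simp]: "space (future p) = space M"
  by (simp add: future_def restarted_cylinders_def space_measure_of_conv)

lemma sets_future: "sets (future p) = sigma_sets (space M) (restarted_cylinders p)"
  unfolding future_def by (rule sets_measure_of) (auto simp: restarted_cylinders_def)

lemma measurable_ident_future: "0 \<le> p \<Longrightarrow> (\<lambda>\<omega>. \<omega>) \<in> M \<rightarrow>\<^sub>M future p"
proof (rule measurableI)
  fix E assume p: "0 \<le> p" and "E \<in> sets (future p)"
  then have "E \<in> events"
    unfolding sets_future using sets.sigma_sets_subset[OF restarted_cylinders_subset[OF p]] by auto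
  then show "(\<lambda>\<omega>. \<omega>) -` E \<inter> space M \<in> events" by (simp add: sets.Int_space_eq2)
qed simp

lemma restarted_measurable_future: "restarted p t \<in> borel_measurable (future p)"
proof (rule measurableI)
  fix A :: "real set" assume A: "A \<in> sets borel"
  have "restarted p t -` A \<inter> space (future p) = {\<omega> \<in> space M. \<forall>s\<in>{t}. restarted p s \<omega> \<in> (\<lambda>_. A) s}"
    by auto
  moreover have "\<dots> \<in> restarted_cylinders p"
    unfolding restarted_cylinders_def by (intro CollectI exI[of _ "{t}"] exI[of _ "\<lambda>_. A"]) (simp add: A)
  ultimately show "restarted p t -` A \<inter> space (future p) \<in> sets (future p)"
    unfolding sets_future by (simp only: sigma_sets.Basic)
qed simp

text \<open>Independence is assumed only for increments over finitely many ordered times. The values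
  of the restarted process at the times of \<open>I\<close> are partial sums of such increments
  after \<open>p\<close>, while the past is the single increment from 0 to \<open>p\<close>.\<close>

lemma prob_past_Int_cylinder:
  assumes p: "0 < p" and I: "finite I" and A: "\<And>t. A t \<in> sets borel" and B: "B \<in> sets borel"
  shows "prob ({\<omega> \<in> space M. S p \<omega> - S 0 \<omega> \<in> B} \<inter> {\<omega> \<in> space M. \<forall>t\<in>I. restarted p t \<omega> \<in> A t}) =
    prob {\<omega> \<in> space M. S p \<omega> - S 0 \<omega> \<in> B} * prob {\<omega> \<in> space M. \<forall>t\<in>I. restarted p t \<omega> \<in> A t}"
proof -
  \<comment> \<open>Including \<open>p\<close> makes the list nonempty with \<open>p\<close> as its
    first entry, because all other entries are at least \<open>p\<close>.\<close>
  define xs where "xs = sorted_list_of_set (max p ` insert p I)"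
  define m where "m = length xs"
  have set_xs: "set xs = max p ` insert p I"
    unfolding xs_def by (rule sorted_list_of_set.set_sorted_key_list_of_set) (simp add: I)
  have sorted: "xs ! i < xs ! j" if "i < j" "j < m" for i j
    using sorted_wrt_nth_less[OF strict_sorted_list_of_set] that by (simp add: xs_def m_def)
  have "p \<in> set xs" unfolding set_xs by force
  then obtain i where i: "i < m" "xs ! i = p" by (auto simp: in_set_conv_nth m_def)
  have ge: "p \<le> xs ! j" if "j < m" for j
    using nth_mem[of j xs] that unfolding set_xs m_def by auto
  have xs0: "xs ! 0 = p"
    using sorted[of 0 i] ge[of 0] i by (cases "i = 0") auto
  have m: "0 < m" using i by simp
  have "\<forall>t\<in>I. \<exists>j<m. xs ! j = max p t"
  proof
    fix t assume "t \<in> I"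
    then have "max p t \<in> set xs" unfolding set_xs by auto
    then show "\<exists>j<m. xs ! j = max p t" by (auto simp: in_set_conv_nth m_def)
  qed
  then obtain j where j: "\<And>t. t \<in> I \<Longrightarrow> j t < m" "\<And>t. t \<in> I \<Longrightarrow> xs ! j t = max p t" by metis
  \<comment> \<open>Time 0 is put in front, so increment number 0 is the past and the increments
    from 1 on belong to the future.\<close>
  define T where "T i = (case i of 0 \<Rightarrow> 0 | Suc i \<Rightarrow> xs ! i)" for i :: nat
  have T: "T 0 = 0" "T (Suc i) = xs ! i" for i by (simp_all add: T_def)
  have Tless: "T i < T (Suc i)" if "i < m" for i
    using that p xs0 sorted by (cases i) (auto simp: T)
  define D where "D i \<omega> = S (T (Suc i)) \<omega> - S (T i) \<omega>" for i \<omega>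
  have ind: "indep_vars (\<lambda>_. borel) D {..<m}"
    unfolding D_def[abs_def] using Tless by (intro independent_increments) (auto simp: T)
  have ind2: "indep_var (PiM {0} (\<lambda>_. borel)) (\<lambda>\<omega>. restrict (\<lambda>i. D i \<omega>) {0})
      (PiM {1..<m} (\<lambda>_. borel)) (\<lambda>\<omega>. restrict (\<lambda>i. D i \<omega>) {1..<m})"
    using m by (intro indep_var_restrict[OF ind]) auto
  have sum_D: "(\<Sum>i\<in>{1..<Suc n}. D i \<omega>) = S (xs ! n) \<omega> - S p \<omega>" for n \<omega>
  proof (induction n)
    case (Suc n)
    have "{1..<Suc (Suc n)} = insert (Suc n) {1..<Suc n}" by auto
    then show ?case using Suc by (simp add: D_def T)
  qed (simp add: xs0)
  define Xa where "Xa = {f \<in> space (PiM {0::nat} (\<lambda>_. borel :: real measure)). f 0 \<in> B}"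
  define Xb where "Xb = {f \<in> space (PiM {1..<m} (\<lambda>_. borel :: real measure)). \<forall>t\<in>I. (\<Sum>i\<in>{1..<Suc (j t)}. f i) \<in> A t}"
  have Xa: "Xa \<in> sets (PiM {0} (\<lambda>_. borel))"
    unfolding Xa_def using B by measurable
  have Xb: "Xb \<in> sets (PiM {1..<m} (\<lambda>_. borel))"
    unfolding Xb_def
  proof (rule sets.sets_Collect_finite_All[OF _ I])
    show "{f \<in> space (PiM {1..<m} (\<lambda>_. borel)). (\<Sum>i\<in>{1..<Suc (j t)}. f i) \<in> A t} \<in> sets (PiM {1..<m} (\<lambda>_. borel))"
      if t: "t \<in> I" for t
    proof -
      have [measurable]: "(\<lambda>f :: nat \<Rightarrow> real. \<Sum>i\<in>{1..<Suc (j t)}. f i) \<in> borel_measurable (PiM {1..<m} (\<lambda>_. borel))"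
        by (rule borel_measurable_sum[where f="\<lambda>i f. f i"], rule measurable_component_singleton)
          (use j(1)[OF t] in auto)
      show ?thesis using A[of t] by measurable
    qed
  qed
  have a: "(\<lambda>\<omega>. restrict (\<lambda>i. D i \<omega>) {0}) -` Xa \<inter> space M = {\<omega> \<in> space M. S p \<omega> - S 0 \<omega> \<in> B}"
    by (auto simp: Xa_def space_PiM D_def T xs0)
  have b: "(\<lambda>\<omega>. restrict (\<lambda>i. D i \<omega>) {1..<m}) -` Xb \<inter> space M = {\<omega> \<in> space M. \<forall>t\<in>I. restarted p t \<omega> \<in> A t}"
  proof -
    define R where "R \<omega> = restrict (\<lambda>i. D i \<omega>) {1..<m}" for \<omega>
    have sum_R: "(\<Sum>i\<in>{1..<Suc (j t)}. R \<omega> i) = restarted p t \<omega>" if "t \<in> I" for t \<omega>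
    proof -
      have "(\<Sum>i\<in>{1..<Suc (j t)}. R \<omega> i) = (\<Sum>i\<in>{1..<Suc (j t)}. D i \<omega>)"
        using j(1)[OF that] by (intro sum.cong) (auto simp: R_def)
      then show ?thesis unfolding sum_D j(2)[OF that] restarted_def .
    qed
    have "R \<omega> \<in> space (PiM {1..<m} (\<lambda>_. borel))" for \<omega>
      by (simp add: R_def space_PiM)
    then have "R \<omega> \<in> Xb \<longleftrightarrow> (\<forall>t\<in>I. (\<Sum>i\<in>{1..<Suc (j t)}. R \<omega> i) \<in> A t)" for \<omega>
      unfolding Xb_def by blast
    then have "R \<omega> \<in> Xb \<longleftrightarrow> (\<forall>t\<in>I. restarted p t \<omega> \<in> A t)" for \<omega>
      using sum_R by metis
    then show ?thesis unfolding R_def by blast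
  qed
  have ab: "(\<lambda>\<omega>. (restrict (\<lambda>i. D i \<omega>) {0}, restrict (\<lambda>i. D i \<omega>) {1..<m})) -` (Xa \<times> Xb) \<inter> space M =
     {\<omega> \<in> space M. S p \<omega> - S 0 \<omega> \<in> B} \<inter> {\<omega> \<in> space M. \<forall>t\<in>I. restarted p t \<omega> \<in> A t}"
    unfolding a[symmetric] b[symmetric] by blast
  show ?thesis
    using indep_varD[OF ind2 Xa Xb] unfolding a b ab .
qed

text \<open>The second component is the sample point itself, seen only through
  \<open>future p\<close>. Thus the whole restarted path is independent of the past without a path
  space. The cylinders are closed under intersection and so suffice.\<close>

lemma indep_past_future:
  assumes p: "0 < p"
  shows "distr M borel (\<lambda>\<omega>. S p \<omega> - S 0 \<omega>) \<Otimes>\<^sub>M distr M (future p) (\<lambda>\<omega>. \<omega>) =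
    distr M (borel \<Otimes>\<^sub>M future p) (\<lambda>\<omega>. (S p \<omega> - S 0 \<omega>, \<omega>))"
proof -
  have X[measurable]: "(\<lambda>\<omega>. S p \<omega> - S 0 \<omega>) \<in> borel_measurable M"
    using p by (intro borel_measurable_diff random_variable_at) auto
  define P where "P = {(\<lambda>\<omega>. S p \<omega> - S 0 \<omega>) -` A \<inter> space M | A. A \<in> sets borel}"
  have Int: "Int_stable P"
  proof (rule Int_stableI)
    fix E E' assume "E \<in> P" "E' \<in> P"
    then obtain A A' where "E = (\<lambda>\<omega>. S p \<omega> - S 0 \<omega>) -` A \<inter> space M" "A \<in> sets borel"
      "E' = (\<lambda>\<omega>. S p \<omega> - S 0 \<omega>) -` A' \<inter> space M" "A' \<in> sets borel" unfolding P_def by blast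
    then have "E \<inter> E' = (\<lambda>\<omega>. S p \<omega> - S 0 \<omega>) -` (A \<inter> A') \<inter> space M" "A \<inter> A' \<in> sets borel" by auto
    then show "E \<inter> E' \<in> P" unfolding P_def by blast
  qed
  have "indep_set P (restarted_cylinders p)"
  proof (rule indep_setI)
    show "P \<subseteq> events" by (auto simp: P_def)
    show "restarted_cylinders p \<subseteq> events" using p by (intro restarted_cylinders_subset) simp
    fix E E' assume "E \<in> P" "E' \<in> restarted_cylinders p"
    then obtain A I A' where A: "E = (\<lambda>\<omega>. S p \<omega> - S 0 \<omega>) -` A \<inter> space M" "A \<in> sets borel"
      and E': "E' = {\<omega> \<in> space M. \<forall>t\<in>I. restarted p t \<omega> \<in> A' t}" "finite I" "\<And>t. A' t \<in> sets borel"
      unfolding P_def restarted_cylinders_def by blast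
    have E: "E = {\<omega> \<in> space M. S p \<omega> - S 0 \<omega> \<in> A}" using A by auto
    show "prob (E \<inter> E') = prob E * prob E'"
      unfolding E E'(1) by (rule prob_past_Int_cylinder[OF p E'(2,3) A(2)])
  qed
  then have ind: "indep_set (sigma_sets (space M) P) (sigma_sets (space M) (restarted_cylinders p))"
    by (rule indep_set_sigma_sets[OF _ Int Int_stable_restarted_cylinders])
  have id[measurable]: "(\<lambda>\<omega>. \<omega>) \<in> M \<rightarrow>\<^sub>M future p"
    using p by (intro measurable_ident_future) simp
  have XY[measurable]: "(\<lambda>\<omega>. (S p \<omega> - S 0 \<omega>, \<omega>)) \<in> M \<rightarrow>\<^sub>M borel \<Otimes>\<^sub>M future p"
    using X id by (rule measurable_Pair)
  interpret X: prob_space "distr M borel (\<lambda>\<omega>. S p \<omega> - S 0 \<omega>)" by (rule prob_space_distr[OF X])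
  interpret Y: prob_space "distr M (future p) (\<lambda>\<omega>. \<omega>)" by (rule prob_space_distr[OF id])
  show ?thesis
  proof (rule pair_measure_eqI)
    show "sigma_finite_measure (distr M borel (\<lambda>\<omega>. S p \<omega> - S 0 \<omega>))" ..
    show "sigma_finite_measure (distr M (future p) (\<lambda>\<omega>. \<omega>))" ..
    show "sets (distr M borel (\<lambda>\<omega>. S p \<omega> - S 0 \<omega>) \<Otimes>\<^sub>M distr M (future p) (\<lambda>\<omega>. \<omega>)) =
        sets (distr M (borel \<Otimes>\<^sub>M future p) (\<lambda>\<omega>. (S p \<omega> - S 0 \<omega>, \<omega>)))"
      unfolding sets_distr by (rule sets_pair_measure_cong) simp_all
  next
    fix A E assume "A \<in> sets (distr M borel (\<lambda>\<omega>. S p \<omega> - S 0 \<omega>))" "E \<in> sets (distr M (future p) (\<lambda>\<omega>. \<omega>))"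
    then have A: "A \<in> sets borel" and E: "E \<in> sets (future p)" by simp_all
    have "(\<lambda>\<omega>. S p \<omega> - S 0 \<omega>) -` A \<inter> space M \<in> sigma_sets (space M) P"
      using A by (auto simp: P_def)
    moreover have "E \<in> sigma_sets (space M) (restarted_cylinders p)"
      using E by (simp add: sets_future)
    ultimately have "prob (((\<lambda>\<omega>. S p \<omega> - S 0 \<omega>) -` A \<inter> space M) \<inter> E) =
      prob ((\<lambda>\<omega>. S p \<omega> - S 0 \<omega>) -` A \<inter> space M) * prob E"
      by (rule indep_setD[OF ind])
    moreover have sub: "E \<subseteq> space M" using sets.sets_into_space[OF E] by simp
    have "(\<lambda>\<omega>. (S p \<omega> - S 0 \<omega>, \<omega>)) -` (A \<times> E) \<inter> space M = ((\<lambda>\<omega>. S p \<omega> - S 0 \<omega>) -` A \<inter> space M) \<inter> E"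
      using sub by auto
    moreover have "(\<lambda>\<omega>. \<omega>) -` E \<inter> space M = E" using sub by auto
    ultimately show "emeasure (distr M borel (\<lambda>\<omega>. S p \<omega> - S 0 \<omega>)) A * emeasure (distr M (future p) (\<lambda>\<omega>. \<omega>)) E =
      emeasure (distr M (borel \<Otimes>\<^sub>M future p) (\<lambda>\<omega>. (S p \<omega> - S 0 \<omega>, \<omega>))) (A \<times> E)"
      using A E by (simp add: emeasure_distr emeasure_eq_measure ennreal_mult)
  qed
qed

end

section \<open>Convolution of densities and the Laplace exponent\<close>

text \<open>Half of a convolution: the factor \<open>a\<close> is only evaluated in \<open>[z/2, z]\<close>, away from its
  possible singularity at 0, so dominated convergence applies.\<close>

lemma tendsto_half_convolution:
  fixes a b :: "real \<Rightarrow> real" and z :: "nat \<Rightarrow> real"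
  assumes [measurable]: "a \<in> borel_measurable borel" "b \<in> borel_measurable borel"
    and a: "continuous_on {0<..} a" and b0: "\<And>x. x \<le> 0 \<Longrightarrow> b x = 0" "\<And>x. 0 \<le> b x" "\<And>x. 0 \<le> a x"
    and b: "(\<integral>\<^sup>+x. ennreal (b x) \<partial>lborel) < \<infinity>"
    and z: "z \<longlonglongrightarrow> l" and l: "0 < l"
  shows "(\<lambda>n. \<integral>\<^sup>+x. ennreal (a (z n - x) * b x) * indicator {..<z n / 2} x \<partial>lborel) \<longlonglongrightarrow>
      (\<integral>\<^sup>+x. ennreal (a (l - x) * b x) * indicator {..<l / 2} x \<partial>lborel)"
proof -
  have "\<forall>\<^sub>F n in sequentially. z n \<in> {l/2<..<2*l}"
    using z l by (intro order_tendstoD(1)[OF tendsto_compose] topological_tendstoD) auto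
  then obtain n0 where n0: "\<And>n. n \<ge> n0 \<Longrightarrow> l / 2 < z n \<and> z n < 2 * l"
    unfolding eventually_sequentially by auto
  \<comment> \<open>For z in (l / 2, 2 * l) and 0 < x < z / 2 the argument z - x lies in
    [l / 4, 2 * l], where \<open>a\<close> is bounded.\<close>
  have "compact (a ` {l/4..2*l})"
    using l by (intro compact_continuous_image continuous_on_subset[OF a]) auto
  then obtain K where "\<forall>y\<in>a ` {l/4..2*l}. \<bar>y\<bar> \<le> K"
    using compact_imp_bounded bounded_real by metis
  then have K: "a x \<le> K" if "l / 4 \<le> x" "x \<le> 2 * l" for x
    using that by (meson abs_le_D1 atLeastAtMost_iff imageI)
  have K0: "0 \<le> K" using K[of l] b0(3)[of l] l by auto
  have "(\<lambda>n. \<integral>\<^sup>+x. ennreal (a (z (n + n0) - x) * b x) * indicator {..<z (n + n0) / 2} x \<partial>lborel) \<longlonglongrightarrow>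
      (\<integral>\<^sup>+x. ennreal (a (l - x) * b x) * indicator {..<l / 2} x \<partial>lborel)"
  proof (rule nn_integral_dominated_convergence)
    show "(\<integral>\<^sup>+x. ennreal (K * b x) \<partial>lborel) < \<infinity>"
      using K0 b b0 by (simp add: ennreal_mult nn_integral_cmult ennreal_mult_less_top)
    show "AE x in lborel. ennreal (a (z (n + n0) - x) * b x) * indicator {..<z (n + n0) / 2} x \<le> ennreal (K * b x)" for n
    proof (rule AE_I2)
      fix x
      show "ennreal (a (z (n + n0) - x) * b x) * indicator {..<z (n + n0) / 2} x \<le> ennreal (K * b x)"
      proof (cases "0 < x \<and> x < z (n + n0) / 2")
        case True
        then have "a (z (n + n0) - x) \<le> K" using n0[of "n + n0"] by (intro K) auto
        then show ?thesis using True b0 by (auto intro!: ennreal_leI mult_right_mono)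
      next
        case False
        then show ?thesis using b0(1)[of x] by (cases "0 < x") auto
      qed
    qed
    have "AE x in lborel. x \<noteq> l / 2" by (rule AE_lborel_singleton)
    then show "AE x in lborel. (\<lambda>n. ennreal (a (z (n + n0) - x) * b x) * indicator {..<z (n + n0) / 2} x)
        \<longlonglongrightarrow> ennreal (a (l - x) * b x) * indicator {..<l / 2} x"
    proof eventually_elim
      fix x assume x: "x \<noteq> l / 2"
      have z': "(\<lambda>n. z (n + n0)) \<longlonglongrightarrow> l" by (rule LIMSEQ_ignore_initial_segment[OF z])
      have zh: "(\<lambda>n. z (n + n0) / 2) \<longlonglongrightarrow> l / 2" using z' by (rule tendsto_divide) auto
      show "(\<lambda>n. ennreal (a (z (n + n0) - x) * b x) * indicator {..<z (n + n0) / 2} x)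
        \<longlonglongrightarrow> ennreal (a (l - x) * b x) * indicator {..<l / 2} x"
      proof (cases "x < l / 2")
        case True
        have "isCont a (l - x)" using a True l
          by (intro continuous_on_interior[of "{0<..}"]) (auto simp: interior_open)
        then have "(\<lambda>n. ennreal (a (z (n + n0) - x) * b x)) \<longlonglongrightarrow> ennreal (a (l - x) * b x)"
          by (intro tendsto_ennrealI tendsto_mult isCont_tendsto_compose[where g=a] tendsto_diff z' tendsto_const) auto
        moreover have "\<forall>\<^sub>F n in sequentially. x < z (n + n0) / 2"
          using zh True by (rule order_tendstoD(1))
        then have "\<forall>\<^sub>F n in sequentially. ennreal (a (z (n + n0) - x) * b x) =
            ennreal (a (z (n + n0) - x) * b x) * indicator {..<z (n + n0) / 2} x"
          by eventually_elim simp
        ultimately show ?thesis using True by (simp add: Lim_transform_eventually)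
      next
        case False
        then have "\<forall>\<^sub>F n in sequentially. z (n + n0) / 2 < x"
          using x by (intro order_tendstoD(2)[OF zh]) auto
        then have "\<forall>\<^sub>F n in sequentially. 0 =
            ennreal (a (z (n + n0) - x) * b x) * indicator {..<z (n + n0) / 2} x"
          by eventually_elim simp
        then have "(\<lambda>n. ennreal (a (z (n + n0) - x) * b x) * indicator {..<z (n + n0) / 2} x) \<longlonglongrightarrow> 0"
          by (rule Lim_transform_eventually[OF tendsto_const])
        then show ?thesis using False by simp
      qed
    qed
  qed measurable
  then show ?thesis by (rule LIMSEQ_offset)
qed

text \<open>The substitution x -> z - x in the upper half exchanges the factors, so in each part the
  factor evaluated at z - x stays away from 0.\<close>

lemma nn_integral_convolution_split:
  fixes a b :: "real \<Rightarrow> real"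
  assumes [measurable]: "a \<in> borel_measurable borel" "b \<in> borel_measurable borel"
  shows "(\<integral>\<^sup>+x. ennreal (a (z - x) * b x) \<partial>lborel) =
    (\<integral>\<^sup>+x. ennreal (a (z - x) * b x) * indicator {..<z / 2} x \<partial>lborel) +
    (\<integral>\<^sup>+x. ennreal (b (z - x) * a x) * indicator {..<z / 2} x \<partial>lborel)"
proof -
  have "(\<integral>\<^sup>+x. ennreal (a (z - x) * b x) \<partial>lborel) =
    (\<integral>\<^sup>+x. ennreal (a (z - x) * b x) * indicator {..<z / 2} x +
       ennreal (a (z - x) * b x) * indicator {z / 2<..} x \<partial>lborel)"
    using AE_lborel_singleton[of "z / 2"]
    by (intro nn_integral_cong_AE, eventually_elim) (auto split: split_indicator)
  also have "\<dots> = (\<integral>\<^sup>+x. ennreal (a (z - x) * b x) * indicator {..<z / 2} x \<partial>lborel) +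
     (\<integral>\<^sup>+x. ennreal (a (z - x) * b x) * indicator {z / 2<..} x \<partial>lborel)"
    by (rule nn_integral_add) measurable
  also have "(\<integral>\<^sup>+x. ennreal (a (z - x) * b x) * indicator {z / 2<..} x \<partial>lborel) =
     (\<integral>\<^sup>+x. ennreal (a (z - (z + - 1 * x)) * b (z + - 1 * x)) * indicator {z / 2<..} (z + - 1 * x) \<partial>lborel)"
    by (subst nn_integral_real_affine[where t=z and c="-1"]) auto
  also have "\<dots> = (\<integral>\<^sup>+x. ennreal (b (z - x) * a x) * indicator {..<z / 2} x \<partial>lborel)"
    by (intro nn_integral_cong) (auto split: split_indicator simp: mult.commute)
  finally show ?thesis .
qed

text \<open>Points where the equality holds accumulate at z from the right, and both sides are
  continuous at z > 0. For z <= 0 both sides vanish.\<close>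

lemma convolution_eq_everywhere:
  fixes a b h :: "real \<Rightarrow> real"
  assumes a: "a \<in> borel_measurable borel" "continuous_on {0<..} a" "\<And>x. x \<le> 0 \<Longrightarrow> a x = 0" "\<And>x. 0 \<le> a x"
      "(\<integral>\<^sup>+x. ennreal (a x) \<partial>lborel) < \<infinity>"
    and b: "b \<in> borel_measurable borel" "continuous_on {0<..} b" "\<And>x. x \<le> 0 \<Longrightarrow> b x = 0" "\<And>x. 0 \<le> b x"
      "(\<integral>\<^sup>+x. ennreal (b x) \<partial>lborel) < \<infinity>"
    and h: "continuous_on {0<..} h" "\<And>x. x \<le> 0 \<Longrightarrow> h x = 0"
    and eq: "AE z in lborel. (\<integral>\<^sup>+x. ennreal (a (z - x) * b x) \<partial>lborel) = ennreal (h z)"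
  shows "(\<integral>\<^sup>+x. ennreal (a (z - x) * b x) \<partial>lborel) = ennreal (h z)"
proof (cases "0 < z")
  case False
  then have zero: "ennreal (a (z - x) * b x) = 0" for x
    using a(3)[of "z - x"] b(3)[of x] by (cases "0 < x") auto
  show ?thesis unfolding zero using False h(2) by simp
next
  case z: True
  have "\<exists>y. z < y \<and> y < z + 1 / real (Suc n) \<and> (\<integral>\<^sup>+x. ennreal (a (y - x) * b x) \<partial>lborel) = ennreal (h y)" for n
  proof (rule ccontr)
    assume no: "\<not> ?thesis"
    have "AE y in lborel. y \<notin> {z<..<z + 1 / real (Suc n)}"
      using eq by eventually_elim (use no in auto)
    then have "emeasure lborel {z<..<z + 1 / real (Suc n)} = 0"
      by (subst (asm) AE_iff_measurable[OF _ refl]) (auto simp: greaterThanLessThan_def greaterThan_def lessThan_def Collect_conj_eq)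
    then show False by (simp add: ennreal_eq_0_iff)
  qed
  then obtain y where y: "\<And>n. z < y n" "\<And>n. y n < z + 1 / real (Suc n)"
    and yeq: "\<And>n. (\<integral>\<^sup>+x. ennreal (a (y n - x) * b x) \<partial>lborel) = ennreal (h (y n))"
    by metis
  have ylim: "y \<longlonglongrightarrow> z"
  proof (rule tendsto_sandwich[OF _ _ tendsto_const])
    show "(\<lambda>n. z + 1 / real (Suc n)) \<longlonglongrightarrow> z"
      using LIMSEQ_inverse_real_of_nat_add[of z] by (simp only: inverse_eq_divide)
    show "\<forall>\<^sub>F n in sequentially. z \<le> y n" "\<forall>\<^sub>F n in sequentially. y n \<le> z + 1 / real (Suc n)"
      using y by (blast intro: always_eventually less_imp_le)+
  qed
  have "isCont h z" using h(1) z by (intro continuous_on_interior[of "{0<..}"]) (auto simp: interior_open)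
  then have "(\<lambda>n. ennreal (h (y n))) \<longlonglongrightarrow> ennreal (h z)"
    using ylim by (intro tendsto_ennrealI isCont_tendsto_compose[where g=h])
  moreover have "(\<lambda>n. ennreal (h (y n))) \<longlonglongrightarrow> (\<integral>\<^sup>+x. ennreal (a (z - x) * b x) \<partial>lborel)"
    unfolding yeq[symmetric] nn_integral_convolution_split[OF a(1) b(1)]
    by (intro tendsto_add tendsto_half_convolution a b ylim z)
  ultimately show ?thesis by (metis LIMSEQ_unique)
qed

section \<open>From the Laplace exponent to truncated means\<close>

text \<open>Bounds a truncated variable by a Laplace transform. The factor 2 comes from exp (- v) <=
  1 / (1 + v) <= 1 - v / 2 for v in [0, 1].\<close>

lemma min_le_exp:
  fixes x q :: real
  assumes x: "0 \<le> x" and q: "0 < q"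
  shows "min (1 / q) x \<le> 2 / q * (1 - exp (- q * x))"
proof -
  have *: "min 1 u \<le> 2 * (1 - exp (- u))" if "0 \<le> u" for u :: real
  proof -
    define v where "v = min 1 u"
    have v: "0 \<le> v" "v \<le> 1" "v \<le> u" using that by (auto simp: v_def)
    have "1 + v \<le> exp v" by (rule exp_ge_add_one_self)
    then have "exp (- v) \<le> 1 / (1 + v)"
      using v by (simp add: exp_minus divide_simps)
    also have "\<dots> \<le> 1 - v / 2"
      using v mult_nonneg_nonneg[of v "1 - v"] by (simp add: divide_simps algebra_simps)
    finally have "exp (- v) \<le> 1 - v / 2" .
    moreover have "exp (- u) \<le> exp (- v)" using v by simp
    ultimately have "exp (- u) \<le> 1 - v / 2" by (rule order_trans[rotated])
    then show ?thesis unfolding v_def[symmetric] by simp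
  qed
  have "min (1 / q) x = min 1 (q * x) / q"
  proof -
    have "1 / q \<le> x \<longleftrightarrow> 1 \<le> q * x" using pos_divide_le_eq[OF q, of 1 x] by (simp only: mult.commute)
    then show ?thesis using q by (simp add: min_def)
  qed
  also have "\<dots> \<le> 2 * (1 - exp (- (q * x))) / q"
    using q x by (intro divide_right_mono *) auto
  finally show ?thesis by (simp add: field_simps)
qed

text \<open>Dominated convergence with \<open>min 1 x\<close>, the function whose integrability
  defines a subordinator Levy measure.\<close>

lemma levy_exponent_sublinear:
  assumes nu: "subordinator_levy_measure \<nu>"
  shows "(\<lambda>n. (LINT x|\<nu>. 1 - exp (- real (Suc n) * x)) / real (Suc n)) \<longlonglongrightarrow> 0"
proof -
  have sets[measurable_cong]: "sets \<nu> = sets borel" and null: "emeasure \<nu> {..0} = 0"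
    and fin: "(\<integral>\<^sup>+ x. ennreal (min 1 x) \<partial>\<nu>) < \<infinity>"
    using nu by (auto simp: subordinator_levy_measure_def)
  have pos: "AE x in \<nu>. 0 < x"
    by (rule AE_I[where N="{..0}"]) (auto simp: null sets)
  have "(\<lambda>n. LINT x|\<nu>. (1 - exp (- real (Suc n) * x)) / real (Suc n)) \<longlonglongrightarrow> (LINT x|\<nu>. 0)"
  proof (rule integral_dominated_convergence)
    show "integrable \<nu> (\<lambda>x. min 1 x)"
    proof (rule integrableI_nonneg)
      show "AE x in \<nu>. 0 \<le> min 1 x" using pos by eventually_elim auto
    qed (use fin in auto)
    show "AE x in \<nu>. (\<lambda>n. (1 - exp (- real (Suc n) * x)) / real (Suc n)) \<longlonglongrightarrow> 0"
      using pos
    proof eventually_elim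
      fix x :: real assume x: "0 < x"
      have "(\<lambda>n. 1 / real (Suc n)) \<longlonglongrightarrow> 0" using LIMSEQ_inverse_real_of_nat by (simp only: inverse_eq_divide)
      then show "(\<lambda>n. (1 - exp (- real (Suc n) * x)) / real (Suc n)) \<longlonglongrightarrow> 0"
      proof (rule tendsto_sandwich[OF _ _ tendsto_const, rotated 2])
        show "\<forall>\<^sub>F n in sequentially. 0 \<le> (1 - exp (- real (Suc n) * x)) / real (Suc n)"
          using x by (intro always_eventually allI divide_nonneg_nonneg)
            (simp_all add: zero_le_mult_iff del: of_nat_Suc)
        show "\<forall>\<^sub>F n in sequentially. (1 - exp (- real (Suc n) * x)) / real (Suc n) \<le> 1 / real (Suc n)"
          by (intro always_eventually allI divide_right_mono) auto
      qed
    qed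
    show "AE x in \<nu>. norm ((1 - exp (- real (Suc n) * x)) / real (Suc n)) \<le> min 1 x" for n
      using pos
    proof eventually_elim
      fix x :: real assume x: "0 < x"
      define m where "m = real (Suc n)"
      have m: "1 \<le> m" by (simp add: m_def)
      have e: "exp (- m * x) \<le> 1" using m x by simp
      have "1 - m * x \<le> exp (- m * x)" using exp_ge_add_one_self[of "- m * x"] by simp
      then have "(1 - exp (- m * x)) / m \<le> x" using m by (simp add: divide_le_eq mult.commute)
      moreover have "(1 - exp (- m * x)) / m \<le> 1" using m by (simp add: divide_le_eq) (smt (verit) exp_gt_zero)
      ultimately show "norm ((1 - exp (- real (Suc n) * x)) / real (Suc n)) \<le> min 1 x"
        unfolding m_def[symmetric] using e m by simp
    qed
  qed measurable
  then show ?thesis by simp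
qed

section \<open>Driftless subordinators with continuous densities\<close>

text \<open>Reduces strict increase of a path to countably many almost sure events.\<close>

lemma strict_mono_on_if_Rats:
  fixes f :: "real \<Rightarrow> real"
  assumes f: "mono f" and rat: "\<And>r s. r \<in> \<rat> \<Longrightarrow> s \<in> \<rat> \<Longrightarrow> a < r \<Longrightarrow> r < s \<Longrightarrow> f r < f s"
  shows "strict_mono_on {a<..} f"
proof (rule strict_mono_onI)
  fix r s assume rs: "r \<in> {a<..}" "s \<in> {a<..}" "r < s"
  obtain r' where r': "r' \<in> \<rat>" "r < r'" "r' < s" using Rats_dense_in_real[OF rs(3)] by auto
  obtain s' where s': "s' \<in> \<rat>" "r' < s'" "s' < s" using Rats_dense_in_real[OF r'(3)] by auto
  have "f r \<le> f r'" "f s' \<le> f s" using r' s' by (auto intro!: monoD[OF f])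
  moreover have "f r' < f s'" using rs r' s' by (intro rat) auto
  ultimately show "f r < f s" by linarith
qed

context subordinator
begin

lemma restarted_mono: "0 \<le> p \<Longrightarrow> \<omega> \<in> space M \<Longrightarrow> mono (\<lambda>t. restarted p t \<omega>)"
  using nondecreasing_paths[of \<omega>]
  by (intro monoI) (auto simp: restarted_def intro!: diff_right_mono elim!: mono_onD)

lemma right_continuous_max:
  assumes "0 \<le> p" "\<omega> \<in> space M"
  shows "((\<lambda>s. S (max p s) \<omega>) \<longlongrightarrow> S (max p t) \<omega>) (at_right t)"
proof (cases "p \<le> t")
  case True
  have "((\<lambda>s. S s \<omega>) \<longlongrightarrow> S t \<omega>) (at_right t)"
    using True assms by (intro right_continuous_paths) auto
  moreover have "\<forall>\<^sub>F s in at_right t. S s \<omega> = S (max p s) \<omega>"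
    using True by (intro eventually_at_rightI[of t "t + 1"]) auto
  ultimately show ?thesis using True by (simp add: max_absorb2 Lim_transform_eventually)
next
  case False
  have "\<forall>\<^sub>F s in at_right t. S p \<omega> = S (max p s) \<omega>"
    using False by (intro eventually_at_rightI[of t p]) auto
  then show ?thesis using False by (simp add: max_absorb1 Lim_transform_eventually[OF tendsto_const])
qed

lemma distr_increment:
  assumes "0 \<le> s" "s \<le> t"
  shows "distr M borel (\<lambda>\<omega>. S t \<omega> - S s \<omega>) = distr M borel (S (t - s))"
  using stationary_increments[of s "t - s"] assms by simp

lemma nn_integral_increment:
  assumes [measurable]: "f \<in> borel_measurable borel" and st: "0 \<le> s" "s \<le> t"
  shows "(\<integral>\<^sup>+\<omega>. f (S t \<omega> - S s \<omega>) \<partial>M) = (\<integral>\<^sup>+\<omega>. f (S (t - s) \<omega>) \<partial>M)"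
proof -
  have [measurable]: "S t \<in> borel_measurable M" "S s \<in> borel_measurable M" "S (t - s) \<in> borel_measurable M"
    using st by (auto intro: random_variable_at)
  have "(\<integral>\<^sup>+\<omega>. f (S t \<omega> - S s \<omega>) \<partial>M) = (\<integral>\<^sup>+x. f x \<partial>distr M borel (\<lambda>\<omega>. S t \<omega> - S s \<omega>))"
    by (subst nn_integral_distr) auto
  also have "\<dots> = (\<integral>\<^sup>+x. f x \<partial>distr M borel (S (t - s)))"
    unfolding distr_increment[OF st] ..
  also have "\<dots> = (\<integral>\<^sup>+\<omega>. f (S (t - s) \<omega>) \<partial>M)" by (subst nn_integral_distr) auto
  finally show ?thesis .
qed

lemma AE_nonneg: "0 \<le> t \<Longrightarrow> AE \<omega> in M. 0 \<le> S t \<omega>"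
  using start_zero AE_space
proof eventually_elim
  fix \<omega> assume "0 \<le> t" "S 0 \<omega> = 0" "\<omega> \<in> space M"
  then show "0 \<le> S t \<omega>" using mono_onD[OF nondecreasing_paths, of \<omega> 0 t] by simp
qed

text \<open>With \<Psi> the Laplace exponent at q, the mean of \<open>min (1 / q) (S h)\<close> is
  at most 2 / q * (1 - exp (- h * \<Psi>)) <= 2 * h * \<Psi> / q, which is linear in h with a slope
  that tends to 0 in q.\<close>

lemma driftless_increments_small:
  assumes levy: "has_drift_and_levy_measure M S 0 \<nu>" and e: "0 < e"
  shows "\<exists>d>0. \<forall>s t. 0 \<le> s \<longrightarrow> s < t \<longrightarrow>
    (\<integral>\<^sup>+\<omega>. ennreal (min d (S t \<omega> - S s \<omega>)) \<partial>M) \<le> ennreal (e * (t - s))"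
proof -
  have nu: "subordinator_levy_measure \<nu>"
    and laplace: "\<And>t q. 0 \<le> t \<Longrightarrow> 0 \<le> q \<Longrightarrow>
      (LINT \<omega>|M. exp (- q * S t \<omega>)) = exp (- t * (LINT x|\<nu>. 1 - exp (- q * x)))"
    using levy by (auto simp: has_drift_and_levy_measure_def)
  have "\<forall>\<^sub>F n in sequentially. (LINT x|\<nu>. 1 - exp (- real (Suc n) * x)) / real (Suc n) < e / 2"
    using levy_exponent_sublinear[OF nu] e by (intro order_tendstoD(2)) auto
  then obtain n where n: "(LINT x|\<nu>. 1 - exp (- real (Suc n) * x)) / real (Suc n) < e / 2"
    by (auto simp: eventually_sequentially)
  define q where "q = real (Suc n)"
  define \<Psi> where "\<Psi> = (LINT x|\<nu>. 1 - exp (- q * x))"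
  have q: "0 < q" by (simp add: q_def)
  have \<Psi>: "\<Psi> / q < e / 2" using n by (simp only: \<Psi>_def q_def)
  have bound: "(\<integral>\<^sup>+\<omega>. ennreal (min (1 / q) (S h \<omega>)) \<partial>M) \<le> ennreal (e * h)" if h: "0 < h" for h
  proof -
    have [measurable]: "S h \<in> borel_measurable M" using h by (intro random_variable_at) auto
    have le1: "AE \<omega> in M. exp (- q * S h \<omega>) \<le> 1"
      using AE_nonneg[of h] h q by (auto elim!: eventually_mono simp: mult_nonneg_nonneg)
    have int: "integrable M (\<lambda>\<omega>. exp (- q * S h \<omega>))"
      by (rule integrable_const_bound[of _ 1]) (use le1 in auto)
    have "(\<integral>\<^sup>+\<omega>. ennreal (min (1 / q) (S h \<omega>)) \<partial>M) \<le> (\<integral>\<^sup>+\<omega>. ennreal (2 / q * (1 - exp (- q * S h \<omega>))) \<partial>M)"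
    proof (rule nn_integral_mono_AE)
      show "AE \<omega> in M. ennreal (min (1 / q) (S h \<omega>)) \<le> ennreal (2 / q * (1 - exp (- q * S h \<omega>)))"
        using AE_nonneg[OF less_imp_le[OF h]]
        by eventually_elim (intro ennreal_leI min_le_exp q)
    qed
    also have "\<dots> = ennreal (LINT \<omega>|M. 2 / q * (1 - exp (- q * S h \<omega>)))"
      using int le1 q
      by (intro nn_integral_eq_integral integrable_mult_right Bochner_Integration.integrable_diff)
        (auto elim!: eventually_mono)
    also have "(LINT \<omega>|M. 2 / q * (1 - exp (- q * S h \<omega>))) = 2 / q * (1 - exp (- h * \<Psi>))"
      using int laplace[of h q] h q by (simp add: prob_space \<Psi>_def)
    also have "\<dots> \<le> 2 / q * (h * \<Psi>)"
      using exp_ge_add_one_self[of "- h * \<Psi>"] q by (intro mult_left_mono) auto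
    also have "\<dots> = 2 * h * (\<Psi> / q)" by simp
    also have "\<dots> \<le> 2 * h * (e / 2)" using \<Psi> h by (intro mult_left_mono) auto
    finally show ?thesis by (simp add: mult.commute ennreal_leI)
  qed
  show ?thesis
  proof (intro exI[of _ "1 / q"] conjI allI impI)
    show "0 < 1 / q" using q by simp
    fix s t :: real assume st: "0 \<le> s" "s < t"
    have "(\<integral>\<^sup>+\<omega>. ennreal (min (1 / q) (S t \<omega> - S s \<omega>)) \<partial>M) = (\<integral>\<^sup>+\<omega>. ennreal (min (1 / q) (S (t - s) \<omega>)) \<partial>M)"
      using st by (intro nn_integral_increment) auto
    also have "\<dots> \<le> ennreal (e * (t - s))" using st by (intro bound) auto
    finally show "(\<integral>\<^sup>+\<omega>. ennreal (min (1 / q) (S t \<omega> - S s \<omega>)) \<partial>M) \<le> ennreal (e * (t - s))" .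
  qed
qed

context
  fixes g :: "real \<Rightarrow> real \<Rightarrow> real"
  assumes density: "continuous_density_condition M S g"
begin

lemma density_nonneg: "0 < t \<Longrightarrow> 0 \<le> g t x"
  and density_nonpos_arg: "0 < t \<Longrightarrow> x \<le> 0 \<Longrightarrow> g t x = 0"
  and density_distributed: "0 < t \<Longrightarrow> distributed M lborel (S t) (\<lambda>x. ennreal (g t x))"
  using density by (auto simp: continuous_density_condition_def)

lemma density_measurable: "0 < t \<Longrightarrow> g t \<in> borel_measurable borel"
  using distributed_real_measurable[OF _ density_distributed] density_nonneg by auto

lemma density_continuous: "0 < t \<Longrightarrow> continuous_on {0<..} (g t)"
proof -
  assume t: "0 < t"
  have "continuous_on ({0<..} \<times> {0<..}) (\<lambda>(t, x). g t x)"
    using density by (simp add: continuous_density_condition_def)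
  then have "continuous_on {0<..} ((\<lambda>(t, x). g t x) \<circ> (\<lambda>x. (t, x)))"
    using t by (intro continuous_on_compose continuous_intros) (auto intro: continuous_on_subset)
  then show ?thesis by (simp add: comp_def)
qed

lemma nn_integral_density_increment:
  assumes f: "f \<in> borel_measurable borel" and st: "0 \<le> s" "s < t"
  shows "(\<integral>\<^sup>+\<omega>. f (S t \<omega> - S s \<omega>) \<partial>M) = (\<integral>\<^sup>+x. ennreal (g (t - s) x) * f x \<partial>lborel)"
proof -
  have "(\<integral>\<^sup>+\<omega>. f (S t \<omega> - S s \<omega>) \<partial>M) = (\<integral>\<^sup>+\<omega>. f (S (t - s) \<omega>) \<partial>M)"
    using st f by (intro nn_integral_increment) auto
  also have "\<dots> = (\<integral>\<^sup>+x. ennreal (g (t - s) x) * f x \<partial>lborel)"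
    using st f by (intro distributed_nn_integral[symmetric] density_distributed) auto
  finally show ?thesis .
qed

lemma nn_integral_density: "0 < t \<Longrightarrow> (\<integral>\<^sup>+x. ennreal (g t x) \<partial>lborel) = 1"
  using nn_integral_density_increment[of "\<lambda>_. 1" 0 t] by (simp add: emeasure_space_1)

lemma AE_increment_pos:
  assumes rs: "0 \<le> r" "r < s"
  shows "AE \<omega> in M. S r \<omega> < S s \<omega>"
proof -
  have [measurable]: "S r \<in> borel_measurable M" "S s \<in> borel_measurable M"
    using rs by (auto intro: random_variable_at)
  have "emeasure M {\<omega> \<in> space M. \<not> S r \<omega> < S s \<omega>} =
      (\<integral>\<^sup>+\<omega>. indicator {\<omega> \<in> space M. \<not> S r \<omega> < S s \<omega>} \<omega> \<partial>M)"
    by (rule nn_integral_indicator[symmetric]) measurable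
  also have "\<dots> = (\<integral>\<^sup>+\<omega>. indicator {..0} (S s \<omega> - S r \<omega>) \<partial>M)"
    by (intro nn_integral_cong) (auto simp: indicator_def)
  also have "\<dots> = (\<integral>\<^sup>+x. ennreal (g (s - r) x) * indicator {..0} x \<partial>lborel)"
    using rs by (intro nn_integral_density_increment) auto
  also have "\<dots> = (\<integral>\<^sup>+x. 0 \<partial>(lborel :: real measure))"
    using rs by (intro nn_integral_cong) (auto split: split_indicator simp: density_nonpos_arg)
  finally show ?thesis by (subst AE_iff_measurable[OF _ refl]) auto
qed

text \<open>Two densities of \<open>S t - S 0\<close>, one of them by independence of the increments
  up to \<open>p\<close> and from \<open>p\<close> to \<open>t\<close>, agree almost everywhere;
  continuity turns this into equality at every point.\<close>

lemma density_convolution: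
  assumes p: "0 < p" and t: "p < t"
  shows "(\<integral>\<^sup>+x. ennreal (g p (z - x) * g (t - p) x) \<partial>lborel) = ennreal (g t z)"
proof (rule convolution_eq_everywhere)
  have incr: "distributed M lborel (\<lambda>\<omega>. S u \<omega> - S s \<omega>) (\<lambda>x. ennreal (g (u - s) x))" if "0 \<le> s" "s < u" for s u
  proof -
    have "distr M lborel (\<lambda>\<omega>. S u \<omega> - S s \<omega>) = distr M lborel (S (u - s))"
      using distr_increment[of s u] that by (simp cong: distr_cong)
    moreover have "(\<lambda>\<omega>. S u \<omega> - S s \<omega>) \<in> borel_measurable M"
      using that by (intro borel_measurable_diff random_variable_at) auto
    ultimately show ?thesis
      using density_distributed[of "u - s"] that by (simp add: distributed_def)
  qed
  define T where "T i = (if i = 0 then 0 else if i = 1 then p else t)" for i :: nat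
  define D where "D i \<omega> = S (T (Suc i)) \<omega> - S (T i) \<omega>" for i \<omega>
  have "indep_vars (\<lambda>_. borel) D {..<2}"
    unfolding D_def[abs_def] using p t by (intro independent_increments) (auto simp: T_def less_2_cases_iff)
  then have "indep_var (PiM {0} (\<lambda>_. borel)) (\<lambda>\<omega>. restrict (\<lambda>i. D i \<omega>) {0})
      (PiM {1} (\<lambda>_. borel)) (\<lambda>\<omega>. restrict (\<lambda>i. D i \<omega>) {1})"
    by (rule indep_var_restrict) auto
  then have "indep_var borel ((\<lambda>f. f 0) \<circ> (\<lambda>\<omega>. restrict (\<lambda>i. D i \<omega>) {0}))
      borel ((\<lambda>f. f 1) \<circ> (\<lambda>\<omega>. restrict (\<lambda>i. D i \<omega>) {1}))"
    by (rule indep_var_compose) (auto intro: measurable_component_singleton)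
  then have ind: "indep_var borel (\<lambda>\<omega>. S p \<omega> - S 0 \<omega>) borel (\<lambda>\<omega>. S t \<omega> - S p \<omega>)"
    by (simp add: comp_def D_def T_def)
  have "distributed M lborel (\<lambda>\<omega>. (S p \<omega> - S 0 \<omega>) + (S t \<omega> - S p \<omega>))
      (\<lambda>x. \<integral>\<^sup>+y. ennreal (g (p - 0) (x - y)) * ennreal (g (t - p) y) \<partial>lborel)"
    using p t by (intro distributed_convolution ind incr) auto
  then have "distributed M lborel (\<lambda>\<omega>. S t \<omega> - S 0 \<omega>)
      (\<lambda>x. \<integral>\<^sup>+y. ennreal (g p (x - y) * g (t - p) y) \<partial>lborel)"
    using p t by (simp add: ennreal_mult density_nonneg)
  moreover have "distributed M lborel (\<lambda>\<omega>. S t \<omega> - S 0 \<omega>) (\<lambda>x. ennreal (g t x))"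
    using incr[of 0 t] p t by simp
  ultimately show "AE z in lborel. (\<integral>\<^sup>+x. ennreal (g p (z - x) * g (t - p) x) \<partial>lborel) = ennreal (g t z)"
    by (rule distributed_unique)
qed (use p t in \<open>auto simp: density_nonpos_arg density_nonneg density_measurable density_continuous nn_integral_density\<close>)

end

end

section \<open>Crossing the boundary\<close>

text \<open>The derivative need be neither continuous nor bounded. It is Borel and has a sign as a
  limit of difference quotients, and since it exists at every point, the fundamental theorem for
  nonnegative derivatives applies.\<close>

lemma nn_integral_neg_deriv_antimono:
  fixes c :: "real \<Rightarrow> real"
  assumes cont: "continuous_on {0<..} c" and anti: "antimono_on {0<..} c"
    and al: "0 < al" and diff: "\<And>t. t \<in> {al..be} \<Longrightarrow> c differentiable (at t)"
  defines "k \<equiv> \<lambda>t. if t \<in> {al..be} then - deriv c t else 0"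
  shows "k \<in> borel_measurable borel"
    and "\<And>t. 0 \<le> k t"
    and "\<And>a b. al \<le> a \<Longrightarrow> a \<le> b \<Longrightarrow> b \<le> be \<Longrightarrow>
      (\<integral>\<^sup>+t. ennreal (k t) * indicator {a<..b} t \<partial>lborel) = ennreal (c a - c b)"
proof -
  \<comment> \<open>Clamping at \<open>al\<close> makes \<open>u n\<close> globally measurable; it
    changes nothing on the interval, where both arguments are at least \<open>al\<close>.\<close>
  define u where "u n t = (if t \<in> {al..be} then
    (c (max al t) - c (max al (t + 1 / real (Suc n)))) * real (Suc n) else 0)" for n and t :: real
  have u0: "0 \<le> u n t" for n t
  proof -
    have "max al t \<le> max al (t + 1 / real (Suc n))" by (intro max.mono) auto
    then have "c (max al (t + 1 / real (Suc n))) \<le> c (max al t)"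
      using al by (intro monotone_onD[OF anti]) (auto simp: less_max_iff_disj)
    then have "0 \<le> (c (max al t) - c (max al (t + 1 / real (Suc n)))) * real (Suc n)"
      by (intro mult_nonneg_nonneg) auto
    then show ?thesis
      by (cases "t \<in> {al..be}") (simp_all only: u_def if_True if_False order_refl)
  qed
  have der: "(c has_real_derivative deriv c t) (at t)" if "t \<in> {al..be}" for t
    using diff[OF that] by (simp add: DERIV_deriv_iff_real_differentiable)
  have lim: "(\<lambda>n. u n t) \<longlonglongrightarrow> k t" for t
  proof (cases "t \<in> {al..be}")
    case True
    have "filterlim (\<lambda>n. 1 / real (Suc n)) (at 0) sequentially"
      unfolding filterlim_at using LIMSEQ_inverse_real_of_nat
      by (auto simp: inverse_eq_divide simp del: of_nat_Suc)
    moreover have "((\<lambda>h. (c (t + h) - c t) / h) \<longlongrightarrow> deriv c t) (at 0)"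
      using der[OF True] by (simp add: DERIV_def)
    ultimately have "(\<lambda>n. (c (t + 1 / real (Suc n)) - c t) / (1 / real (Suc n))) \<longlonglongrightarrow> deriv c t"
      by (rule filterlim_compose[rotated])
    then have "(\<lambda>n. - ((c (t + 1 / real (Suc n)) - c t) / (1 / real (Suc n)))) \<longlonglongrightarrow> - deriv c t"
      by (rule tendsto_minus)
    moreover have "- ((c (t + 1 / real (Suc n)) - c t) / (1 / real (Suc n))) = u n t" for n
    proof -
      have "al \<le> t + 1 / real (Suc n)" using True by (simp add: add_increasing2)
      then have "max al (t + 1 / real (Suc n)) = t + 1 / real (Suc n)" "max al t = t"
        using True by (auto simp: max_def)
      then show ?thesis using True unfolding u_def by (simp add: left_diff_distrib del: of_nat_Suc)
    qed
    ultimately show ?thesis using True by (simp add: k_def)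
  next
    case False
    then have "u n t = 0" "k t = 0" for n by (simp_all only: u_def k_def if_False)
    then show ?thesis by simp
  qed
  show k[measurable]: "k \<in> borel_measurable borel"
  proof (rule borel_measurable_LIMSEQ_real[OF lim])
    have "continuous_on UNIV (\<lambda>t. c (max al t))"
      using al by (intro continuous_on_compose2[OF cont] continuous_intros) auto
    then have [measurable]: "(\<lambda>t. c (max al t)) \<in> borel_measurable borel"
      by (rule borel_measurable_continuous_onI)
    have [measurable]: "(\<lambda>t. c (max al (t + h))) \<in> borel_measurable borel" for h
      by (rule measurable_compose[of "\<lambda>t. t + h" _ borel "\<lambda>t. c (max al t)"]) measurable
    show "u n \<in> borel_measurable borel" for n
      unfolding u_def by measurable
  qed
  show k0: "0 \<le> k t" for t
    by (rule LIMSEQ_le_const[OF lim]) (use u0 in auto)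
  fix a b assume ab: "al \<le> a" "a \<le> b" "b \<le> be"
  have "(\<integral>\<^sup>+t. ennreal (k t) * indicator {a<..b} t \<partial>lborel) = (\<integral>\<^sup>+t. ennreal (k t) * indicator {a..b} t \<partial>lborel)"
    using AE_lborel_singleton[of a]
    by (intro nn_integral_cong_AE, eventually_elim) (auto split: split_indicator)
  also have "\<dots> = ennreal (- c b - - c a)"
  proof (rule nn_integral_FTC_Icc[OF k _ _ ab(2)])
    fix t assume "t \<in> {a..b}"
    then have t: "t \<in> {al..be}" using ab by auto
    show "((\<lambda>t. - c t) has_real_derivative k t) (at t)"
      using DERIV_minus[OF der[OF t]] t by (simp add: k_def)
  qed (rule k0)
  finally show "(\<integral>\<^sup>+t. ennreal (k t) * indicator {a<..b} t \<partial>lborel) = ennreal (c a - c b)" by simp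
qed

lemma crossing_time_eq_iff:
  assumes mono: "mono_on {0<..} (\<lambda>t. S t \<omega> - c t)" and t: "0 < t"
  shows "crossing_time S c \<omega> = ereal t \<longleftrightarrow>
    (\<forall>s. 0 < s \<and> s < t \<longrightarrow> S s \<omega> - c s \<le> 0) \<and> (\<forall>s>t. 0 < S s \<omega> - c s)"
proof -
  have "crossing_time S c \<omega> = Inf {ereal s | s. 0 < s \<and> 0 < S s \<omega> - c s}"
    by (simp add: crossing_time_def)
  then show ?thesis using Inf_passage_eq_iff[OF mono t, of 0] by simp
qed

context subordinator
begin

text \<open>The local form: an interval bounded away from 0 leaves room for a restart time
  \<open>p\<close> before it.\<close>

lemma crossing_on_interval:
  fixes c :: "real \<Rightarrow> real" and g :: "real \<Rightarrow> real \<Rightarrow> real"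
  assumes levy: "has_drift_and_levy_measure M S 0 \<nu>"
    and density: "continuous_density_condition M S g"
    and cont: "continuous_on {0<..} c" and anti: "antimono_on {0<..} c"
    and al: "0 < al" "al \<le> be" and diff: "\<And>t. t \<in> {al..be} \<Longrightarrow> c differentiable (at t)"
    and B[measurable]: "B \<in> sets borel" and Bsub: "B \<subseteq> {al<..be}"
  defines "E \<equiv> {\<omega> \<in> space M. \<exists>t\<in>B. crossing_time S c \<omega> = ereal t \<and> S t \<omega> = c t}"
  shows "E \<in> sets M"
    and "(\<lambda>t. ennreal (- deriv c t * g t (c t)) * indicator B t) \<in> borel_measurable borel"
    and "emeasure M E = (\<integral>\<^sup>+t. ennreal (- deriv c t * g t (c t)) * indicator B t \<partial>lborel)"
proof -
  \<comment> \<open>Any point strictly between 0 and \<open>al\<close> would do.\<close>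
  define p where "p = al / 2"
  have p: "0 < p" "p < al" using al by (auto simp: p_def)
  \<comment> \<open>Not the derivative: \<open>c\<close> frozen before \<open>p\<close>, hence
    continuous and antitone on the whole line.\<close>
  define c' where "c' t = c (max p t)" for t
  have c'_cont: "continuous_on UNIV c'"
    unfolding c'_def using p by (intro continuous_on_compose2[OF cont] continuous_intros) auto
  have c'_anti: "antimono c'"
    unfolding c'_def using p by (intro antimonoI monotone_onD[OF anti]) auto
  have c'_eq: "c' t = c t" if "p \<le> t" for t using that by (simp add: c'_def max_absorb2)
  have c'_lim: "(c' \<longlongrightarrow> c' t) (at_right t)" for t
    using c'_cont by (auto simp: continuous_on_def intro: filterlim_mono[OF _ order_refl at_le])
  have S_mono: "mono_on {0<..} (\<lambda>t. S t \<omega> - c t)" if "\<omega> \<in> space M" for \<omega>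
    using nondecreasing_paths[OF that] monotone_onD[OF anti]
    by (auto simp: mono_on_def intro!: diff_mono)
  \<comment> \<open>\<open>Z\<close> is \<open>S - c\<close> itself, to be caught at level 0, and
    serves to describe and measure the event. The process \<open>Y\<close> below is the restarted
    one, caught at the level minus \<open>S p\<close>.\<close>
  interpret Z: increasing_process M "\<lambda>t \<omega>. S (max p t) \<omega> - c' t"
  proof
    show "(\<lambda>\<omega>. S (max p t) \<omega> - c' t) \<in> borel_measurable M" for t
      using p by (intro borel_measurable_diff random_variable_at) auto
    fix \<omega> assume w: "\<omega> \<in> space M"
    show "mono (\<lambda>t. S (max p t) \<omega> - c' t)"
    proof (rule monoI)
      fix r s :: real assume "r \<le> s"
      then show "S (max p r) \<omega> - c' r \<le> S (max p s) \<omega> - c' s"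
        unfolding c'_def using p by (intro mono_onD[OF S_mono[OF w]]) auto
    qed
    show "((\<lambda>s. S (max p s) \<omega> - c' s) \<longlongrightarrow> S (max p t) \<omega> - c' t) (at_right t)" for t
      using p w by (intro tendsto_diff right_continuous_max c'_lim) auto
  qed
  have id[measurable]: "(\<lambda>\<omega>. \<omega>) \<in> M \<rightarrow>\<^sub>M future p" using p by (intro measurable_ident_future) auto
  \<comment> \<open>The same probability on the smaller \<sigma>-algebra of the future, where the
    independence from \<open>S p\<close> is available.\<close>
  define M' where "M' = distr M (future p) (\<lambda>\<omega>. \<omega>)"
  have space_M' [simp]: "space M' = space M" and sets_M' [measurable_cong]: "sets M' = sets (future p)"
    by (simp_all add: M'_def)
  have Y_meas[measurable]: "restarted p t \<in> borel_measurable M'" for t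
    using restarted_measurable_future[of p t] by (simp cong: measurable_cong_sets add: sets_M')
  have AE_Y: "AE \<omega> in M'. strict_mono_on {p<..} (\<lambda>t. restarted p t \<omega>)"
  proof -
    have less: "AE \<omega> in M'. restarted p r \<omega> < restarted p s \<omega>" if rs: "p < r" "r < s" for r s
    proof -
      note [measurable] = restarted_measurable_future
      have "AE \<omega> in M. restarted p r \<omega> < restarted p s \<omega>"
        using AE_increment_pos[OF density, of r s] p rs by (auto simp: restarted_def elim!: eventually_mono)
      then show ?thesis
        unfolding M'_def by (subst AE_distr_iff[OF id]) measurable
    qed
    have "AE \<omega> in M'. \<forall>r\<in>\<rat>. \<forall>s\<in>\<rat>. p < r \<longrightarrow> r < s \<longrightarrow> restarted p r \<omega> < restarted p s \<omega>"
      by (intro AE_ball_countable[THEN iffD2] ballI countable_rat AE_impI less)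
    with AE_space show ?thesis
    proof eventually_elim
      fix \<omega> assume "\<omega> \<in> space M'"
        and *: "\<forall>r\<in>\<rat>. \<forall>s\<in>\<rat>. p < r \<longrightarrow> r < s \<longrightarrow> restarted p r \<omega> < restarted p s \<omega>"
      then show "strict_mono_on {p<..} (\<lambda>t. restarted p t \<omega>)"
        using p by (intro strict_mono_on_if_Rats restarted_mono) auto
    qed
  qed
  interpret M': prob_space M' unfolding M'_def by (rule prob_space_distr[OF id])
  interpret Y: boundary_crossing M' "restarted p" c' p
  proof
    show "restarted p t \<in> borel_measurable M'" for t by (rule Y_meas)
    show "mono (\<lambda>t. restarted p t \<omega>)" if "\<omega> \<in> space M'" for \<omega>
      using that p by (intro restarted_mono) auto
    show "((\<lambda>s. restarted p s \<omega>) \<longlongrightarrow> restarted p t \<omega>) (at_right t)" if "\<omega> \<in> space M'" for \<omega> t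
      unfolding restarted_def using that p by (intro tendsto_diff right_continuous_max tendsto_const) auto
    show "\<exists>d>0. \<forall>s t. p \<le> s \<longrightarrow> s < t \<longrightarrow>
          (\<integral>\<^sup>+\<omega>. ennreal (min d (restarted p t \<omega> - restarted p s \<omega>)) \<partial>M') \<le> ennreal (e * (t - s))" if "0 < e" for e
    proof -
      obtain d where d: "0 < d" "\<And>s t. 0 \<le> s \<Longrightarrow> s < t \<Longrightarrow>
          (\<integral>\<^sup>+\<omega>. ennreal (min d (S t \<omega> - S s \<omega>)) \<partial>M) \<le> ennreal (e * (t - s))"
        using driftless_increments_small[OF levy \<open>0 < e\<close>] by blast
      show ?thesis
      proof (intro exI[of _ d] conjI allI impI)
        fix s t assume st: "p \<le> s" "s < t"
        note [measurable] = restarted_measurable_future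
        have "(\<integral>\<^sup>+\<omega>. ennreal (min d (restarted p t \<omega> - restarted p s \<omega>)) \<partial>M') =
          (\<integral>\<^sup>+\<omega>. ennreal (min d (restarted p t \<omega> - restarted p s \<omega>)) \<partial>M)"
          unfolding M'_def by (rule nn_integral_distr[OF id]) measurable
        also have "\<dots> = (\<integral>\<^sup>+\<omega>. ennreal (min d (S t \<omega> - S s \<omega>)) \<partial>M)"
          using st by (simp add: restarted_def max_absorb2)
        also have "\<dots> \<le> ennreal (e * (t - s))" using d(2)[of s t] st p by simp
        finally show "(\<integral>\<^sup>+\<omega>. ennreal (min d (restarted p t \<omega> - restarted p s \<omega>)) \<partial>M') \<le> ennreal (e * (t - s))" .
      qed (rule d)
    qed
  qed (rule AE_Y c'_cont c'_anti)+
  have Bp: "B \<subseteq> {p<..}" using Bsub p by auto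
  have E_eq: "E = Pair 0 -` Z.crossings p B"
  proof -
    have "(\<exists>t\<in>B. crossing_time S c \<omega> = ereal t \<and> S t \<omega> = c t) \<longleftrightarrow> (0, \<omega>) \<in> Z.crossings p B"
      if w: "\<omega> \<in> space M" for \<omega>
    proof -
      let ?Z = "\<lambda>t. S (max p t) \<omega> - c' t"
      have Zmono: "mono_on {p<..} ?Z" by (rule monotone_on_subset[OF Z.F_mono[OF w] subset_UNIV])
      have Zeq: "?Z t = S t \<omega> - c t" if "p \<le> t" for t using that by (simp add: c'_eq max_absorb2)
      have iff: "crossing_time S c \<omega> = ereal t \<longleftrightarrow> passage p ?Z 0 = t" if t: "p < t" for t
      proof -
        have "crossing_time S c \<omega> = ereal t \<longleftrightarrow>
            (\<forall>s. 0 < s \<and> s < t \<longrightarrow> S s \<omega> - c s \<le> 0) \<and> (\<forall>s>t. 0 < S s \<omega> - c s)"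
          using p t by (intro crossing_time_eq_iff S_mono w) auto
        also have "\<dots> \<longleftrightarrow> (\<forall>s. p < s \<and> s < t \<longrightarrow> ?Z s \<le> 0) \<and> (\<forall>s>t. 0 < ?Z s)"
        proof (intro conj_cong iffI allI impI)
          fix s assume *: "\<forall>s. p < s \<and> s < t \<longrightarrow> ?Z s \<le> 0" and s: "0 < s \<and> s < t"
          \<comment> \<open>For s at or before \<open>p\<close> the comparison needs a later time in
            (p, t); the midpoint supplies one, and monotonicity of \<open>S - c\<close> carries the
            sign back to s.\<close>
          define r where "r = max s ((p + t) / 2)"
          have r: "p < r" "r < t" "s \<le> r" using s t by (auto simp: r_def less_max_iff_disj)
          have "S s \<omega> - c s \<le> S r \<omega> - c r" using s r by (intro mono_onD[OF S_mono[OF w]]) auto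
          also have "\<dots> \<le> 0" using * r Zeq[of r] by auto
          finally show "S s \<omega> - c s \<le> 0" .
        qed (use p t Zeq in auto)
        also have "\<dots> \<longleftrightarrow> Inf {ereal s | s. p < s \<and> 0 < ?Z s} = ereal t"
          by (rule Inf_passage_eq_iff[OF Zmono t, symmetric])
        \<comment> \<open>As t > p > 0, the junk value 0 of an infinite passage time cannot be
          mistaken for t.\<close>
        also have "\<dots> \<longleftrightarrow> passage p ?Z 0 = t"
          using passage_eqD[of p ?Z 0 t] p t by (auto simp: passage_def)
        finally show ?thesis .
      qed
      show ?thesis
        using w Bp iff Zeq by (force simp: Z.crossings_def)
    qed
    then show ?thesis by (auto simp: E_def Z.crossings_def)
  qed
  show E[measurable]: "E \<in> sets M"
    unfolding E_eq by (rule sets_Pair1[OF Z.sets_crossings[OF B]])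
  define k where "k t = (if t \<in> {al..be} then - deriv c t else 0)" for t
  have k: "k \<in> borel_measurable borel" "\<And>t. 0 \<le> k t"
    "\<And>a b. al \<le> a \<Longrightarrow> a \<le> b \<Longrightarrow> b \<le> be \<Longrightarrow>
      (\<integral>\<^sup>+t. ennreal (k t) * indicator {a<..b} t \<partial>lborel) = ennreal (c a - c b)"
    unfolding k_def by (rule nn_integral_neg_deriv_antimono[OF cont anti al(1)]; use diff in simp)+
  note [measurable] = k(1)
  have kB: "ennreal (- deriv c t * g t (c t)) * indicator B t = ennreal (g t (c t)) * ennreal (k t) * indicator B t" for t
  proof (cases "t \<in> B")
    case True
    then have "k t = - deriv c t" "0 < t" using Bsub al by (auto simp: k_def)
    then show ?thesis using True k(2)[of t] density_nonneg[OF density]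
      by (simp add: ennreal_mult'[symmetric] mult.commute)
  qed simp
  show "(\<lambda>t. ennreal (- deriv c t * g t (c t)) * indicator B t) \<in> borel_measurable borel"
  proof -
    \<comment> \<open>Continuity of the density is known only for positive arguments. Where
      \<open>c t\<close> is not positive, \<open>g t (c t)\<close> vanishes by convention, so the
      indicator of \<open>U\<close> loses nothing.\<close>
    define U where "U = {t \<in> {0<..}. 0 < c t}"
    have "open U"
      unfolding U_def using continuous_open_preimage[OF cont open_greaterThan open_greaterThan[of 0]]
      by (simp add: vimage_def Int_def)
    have "continuous_on U (\<lambda>t. (\<lambda>(t, x). g t x) (t, c t))"
    proof (rule continuous_on_compose2[where g="\<lambda>(t, x). g t x" and f="\<lambda>t. (t, c t)" and t="{0<..} \<times> {0<..}"])
      show "continuous_on ({0<..} \<times> {0<..}) (\<lambda>(t, x). g t x)"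
        using density by (simp add: continuous_density_condition_def)
      show "continuous_on U (\<lambda>t. (t, c t))"
        by (intro continuous_intros continuous_on_subset[OF cont]) (auto simp: U_def)
    qed (auto simp: U_def)
    then have [measurable]: "(\<lambda>t. indicator U t *\<^sub>R g t (c t)) \<in> borel_measurable borel"
      using \<open>open U\<close> by (intro borel_measurable_continuous_on_indicator) auto
    have "ennreal (- deriv c t * g t (c t)) * indicator B t =
      ennreal (indicator U t *\<^sub>R g t (c t)) * ennreal (k t) * indicator B t" for t
    proof (cases "t \<in> B")
      case True
      then have "0 < t" using Bsub al by auto
      then show ?thesis unfolding kB
        using density_nonpos_arg[OF density, of t "c t"] by (cases "0 < c t") (auto simp: U_def)
    qed simp
    then show ?thesis by (subst measurable_cong) (assumption, measurable)
  qed
  let ?X = "\<lambda>\<omega>. S p \<omega> - S 0 \<omega>"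
  have X[measurable]: "?X \<in> borel_measurable M"
    using p by (intro borel_measurable_diff random_variable_at) auto
  \<comment> \<open>The sign: the level reached by the restarted path is minus the past
    increment.\<close>
  define h where "h = (\<lambda>(x, \<omega>). indicator (Y.crossings p B) (- x, \<omega>) :: ennreal)"
  have crossings_sets[measurable]: "Y.crossings p B \<in> sets (borel \<Otimes>\<^sub>M M')"
    by (rule Y.sets_crossings[OF B])
  have h[measurable]: "h \<in> borel_measurable (borel \<Otimes>\<^sub>M M')"
    unfolding h_def by measurable
  have AE_E: "AE \<omega> in M. indicator E \<omega> = h (?X \<omega>, \<omega>)"
    using AE_distrD[OF id Y.AE_path_strict_mono[unfolded M'_def]] AE_distrD[OF id AE_Y[unfolded M'_def]]
      start_zero AE_space
  proof eventually_elim
    fix \<omega> assume w: "\<omega> \<in> space M" and path: "strict_mono_on {p<..} (Y.path \<omega>)" and S0: "S 0 \<omega> = 0"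
    have eq: "S (max p t) \<omega> - c' t = Y.path \<omega> t + S p \<omega>" for t by (simp add: restarted_def)
    have "strict_mono_on {p<..} (\<lambda>t. S (max p t) \<omega> - c' t)"
      unfolding eq using path by (auto simp: strict_mono_on_def)
    then have "\<omega> \<in> E \<longleftrightarrow> 0 \<in> (\<lambda>t. S (max p t) \<omega> - c' t) ` B"
      unfolding E_eq using Z.mem_crossings_iff[OF w _ Bp] by simp
    also have "\<dots> \<longleftrightarrow> - ?X \<omega> \<in> Y.path \<omega> ` B"
    proof -
      have "0 = Y.path \<omega> t + S p \<omega> \<longleftrightarrow> - ?X \<omega> = Y.path \<omega> t" for t using S0 by linarith
      then show ?thesis unfolding eq image_iff by blast
    qed
    also have "\<dots> \<longleftrightarrow> (- ?X \<omega>, \<omega>) \<in> Y.crossings p B"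
      using Y.mem_crossings_iff[OF _ path Bp] w by simp
    finally show "indicator E \<omega> = h (?X \<omega>, \<omega>)" by (simp add: h_def indicator_def)
  qed
  interpret X: prob_space "distr M borel ?X" by (rule prob_space_distr[OF X])
  interpret XM: pair_sigma_finite "distr M borel ?X" M' ..
  have "emeasure M E = (\<integral>\<^sup>+\<omega>. indicator E \<omega> \<partial>M)" by simp
  also have "\<dots> = (\<integral>\<^sup>+\<omega>. h (?X \<omega>, \<omega>) \<partial>M)" by (rule nn_integral_cong_AE[OF AE_E])
  also have "\<dots> = (\<integral>\<^sup>+z. h z \<partial>distr M (borel \<Otimes>\<^sub>M future p) (\<lambda>\<omega>. (?X \<omega>, \<omega>)))"
  proof (rule nn_integral_distr[symmetric])
    show "(\<lambda>\<omega>. (?X \<omega>, \<omega>)) \<in> M \<rightarrow>\<^sub>M borel \<Otimes>\<^sub>M future p" using X id by (rule measurable_Pair)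
    show "h \<in> borel_measurable (distr M (borel \<Otimes>\<^sub>M future p) (\<lambda>\<omega>. (?X \<omega>, \<omega>)))"
      using h by (simp cong: measurable_cong_sets sets_pair_measure_cong add: sets_M')
  qed
  also have "\<dots> = (\<integral>\<^sup>+z. h z \<partial>(distr M borel ?X \<Otimes>\<^sub>M M'))"
    unfolding indep_past_future[OF p(1), symmetric] M'_def ..
  also have "\<dots> = (\<integral>\<^sup>+\<omega>. \<integral>\<^sup>+x. h (x, \<omega>) \<partial>distr M borel ?X \<partial>M')"
    by (rule XM.nn_integral_snd[symmetric]) (use h in \<open>simp cong: measurable_cong_sets sets_pair_measure_cong\<close>)
  also have "\<dots> = (\<integral>\<^sup>+\<omega>. \<integral>\<^sup>+y. ennreal (g p (- y)) * indicator (Y.crossings p B) (y, \<omega>) \<partial>lborel \<partial>M')"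
  proof (rule nn_integral_cong)
    fix \<omega> assume w: "\<omega> \<in> space M'"
    have [measurable]: "(\<lambda>x. h (x, \<omega>)) \<in> borel_measurable borel"
      by (rule measurable_compose[OF measurable_Pair2'[OF w] h])
    note [measurable] = density_measurable[OF density p(1)]
    have "(\<integral>\<^sup>+x. h (x, \<omega>) \<partial>distr M borel ?X) = (\<integral>\<^sup>+\<omega>'. h (?X \<omega>', \<omega>) \<partial>M)"
      by (rule nn_integral_distr) measurable
    also have "\<dots> = (\<integral>\<^sup>+x. ennreal (g (p - 0) x) * h (x, \<omega>) \<partial>lborel)"
      using p by (intro nn_integral_density_increment[OF density]) auto
    \<comment> \<open>Reflection from the increment x to the level y = - x, written as the affine
      substitution 0 + - 1 * y.\<close>
    also have "\<dots> = (\<integral>\<^sup>+y. ennreal (g p (0 + - 1 * y)) * h (0 + - 1 * y, \<omega>) \<partial>lborel)"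
      by (subst nn_integral_real_affine[where t=0 and c="-1"]) auto
    finally show "(\<integral>\<^sup>+x. h (x, \<omega>) \<partial>distr M borel ?X) =
      (\<integral>\<^sup>+y. ennreal (g p (- y)) * indicator (Y.crossings p B) (y, \<omega>) \<partial>lborel)" by (simp add: h_def)
  qed
  also have "\<dots> = (\<integral>\<^sup>+t. (\<integral>\<^sup>+\<omega>. ennreal (g p (- (restarted p t \<omega> - c' t))) \<partial>M') * ennreal (k t) * indicator B t \<partial>lborel)"
  proof (rule Y.nn_integral_crossings[OF p(2) al(2) _ _ _ B Bsub])
    note [measurable] = density_measurable[OF density p(1)]
    show "(\<lambda>y. ennreal (g p (- y))) \<in> borel_measurable borel" by measurable
    show "(\<integral>\<^sup>+t. ennreal (k t) * indicator {a<..b} t \<partial>lborel) = ennreal (c' a - c' b)"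
      if "al \<le> a" "a \<le> b" "b \<le> be" for a b
      using k(3)[OF that] that p by (simp add: c'_eq)
  qed measurable
  also have "\<dots> = (\<integral>\<^sup>+t. ennreal (- deriv c t * g t (c t)) * indicator B t \<partial>lborel)"
  proof (rule nn_integral_cong)
    fix t
    show "(\<integral>\<^sup>+\<omega>. ennreal (g p (- (restarted p t \<omega> - c' t))) \<partial>M') * ennreal (k t) * indicator B t =
      ennreal (- deriv c t * g t (c t)) * indicator B t"
    proof (cases "t \<in> B")
      case True
      then have t: "p < t" using Bp by auto
      note [measurable] = density_measurable[OF density p(1)] restarted_measurable_future
      have "(\<integral>\<^sup>+\<omega>. ennreal (g p (- (restarted p t \<omega> - c' t))) \<partial>M') =
        (\<integral>\<^sup>+\<omega>. ennreal (g p (- (restarted p t \<omega> - c' t))) \<partial>M)"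
        unfolding M'_def by (rule nn_integral_distr[OF id]) measurable
      also have "\<dots> = (\<integral>\<^sup>+\<omega>. ennreal (g p (c t - (S t \<omega> - S p \<omega>))) \<partial>M)"
        using t by (simp add: restarted_def c'_eq max_absorb2)
      also have "\<dots> = (\<integral>\<^sup>+x. ennreal (g (t - p) x) * ennreal (g p (c t - x)) \<partial>lborel)"
        using p t by (intro nn_integral_density_increment[OF density]) measurable
      also have "\<dots> = (\<integral>\<^sup>+x. ennreal (g p (c t - x) * g (t - p) x) \<partial>lborel)"
        using p t density_nonneg[OF density] by (simp add: ennreal_mult mult.commute)
      also have "\<dots> = ennreal (g t (c t))" by (rule density_convolution[OF density p(1) t])
      finally show ?thesis by (simp only: kB)
    qed simp
  qed
  finally show "emeasure M E = (\<integral>\<^sup>+t. ennreal (- deriv c t * g t (c t)) * indicator B t \<partial>lborel)" .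
qed

end

section \<open>Patching the local identities over the open set\<close>

lemma open_countable_Union_intervals:
  fixes G :: "real set"
  assumes "open G" "G \<noteq> {}"
  obtains l u :: "nat \<Rightarrow> real" where "\<And>n. l n \<le> u n" "\<And>n. {l n..u n} \<subseteq> G" "G = (\<Union>n. {l n<..u n})"
proof -
  define Q where "Q = {(a, b) \<in> \<rat> \<times> \<rat>. a \<le> b \<and> {a..b} \<subseteq> G}"
  have "countable Q"
    unfolding Q_def by (rule countable_subset[of _ "\<rat> \<times> \<rat>"]) (auto intro: countable_rat)
  have cover: "\<exists>q\<in>Q. t \<in> {fst q<..snd q}" if t: "t \<in> G" for t
  proof -
    obtain e where e: "0 < e" "ball t e \<subseteq> G" using assms t openE by blast
    obtain a where a: "a \<in> \<rat>" "t - e < a" "a < t" using Rats_dense_in_real[of "t - e" t] e by auto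
    obtain b where b: "b \<in> \<rat>" "t < b" "b < t + e" using Rats_dense_in_real[of t "t + e"] e by auto
    have "{a..b} \<subseteq> ball t e" using a b by (auto simp: dist_real_def)
    then have "(a, b) \<in> Q" using a b e by (auto simp: Q_def)
    then show ?thesis using a b by (intro bexI[of _ "(a, b)"]) auto
  qed
  then have "Q \<noteq> {}" using assms by blast
  show ?thesis
  proof (rule that[of "\<lambda>n. fst (from_nat_into Q n)" "\<lambda>n. snd (from_nat_into Q n)"])
    have mem: "from_nat_into Q n \<in> Q" for n by (rule from_nat_into[OF \<open>Q \<noteq> {}\<close>])
    show "fst (from_nat_into Q n) \<le> snd (from_nat_into Q n)" for n
      using mem[of n] by (auto simp: Q_def)
    show sub: "{fst (from_nat_into Q n)..snd (from_nat_into Q n)} \<subseteq> G" for n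
      using mem[of n] by (auto simp: Q_def)
    show "G = (\<Union>n. {fst (from_nat_into Q n)<..snd (from_nat_into Q n)})"
    proof (intro equalityI subsetI)
      fix t assume "t \<in> G"
      then obtain q where q: "q \<in> Q" "t \<in> {fst q<..snd q}" using cover by blast
      then obtain n where "q = from_nat_into Q n"
        using from_nat_into_surj[OF \<open>countable Q\<close>] by metis
      then show "t \<in> (\<Union>n. {fst (from_nat_into Q n)<..snd (from_nat_into Q n)})" using q by blast
    next
      fix t assume "t \<in> (\<Union>n. {fst (from_nat_into Q n)<..snd (from_nat_into Q n)})"
      then obtain n where "t \<in> {fst (from_nat_into Q n)<..snd (from_nat_into Q n)}" by blast
      then have "t \<in> {fst (from_nat_into Q n)..snd (from_nat_into Q n)}" by simp
      then show "t \<in> G" using sub[of n] by blast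
    qed
  qed
qed

text \<open>Since \<open>G\<close> may come arbitrarily close to 0, no single restart time serves
  all of it. It is exhausted by countably many intervals whose closures lie in \<open>G\<close>,
  each with its own restart time, and the identities are summed over disjoint pieces of
  \<open>B\<close>.\<close>

theorem proposition3p5:
  fixes M :: "'a measure"
    and S :: "real \<Rightarrow> 'a \<Rightarrow> real"
    and \<nu> :: "real measure"
    and c :: "real \<Rightarrow> real"
    and g :: "real \<Rightarrow> real \<Rightarrow> real"
    and G :: "real set"
  assumes "subordinator M S"
    and "has_drift_and_levy_measure M S 0 \<nu>"
    and "emeasure \<nu> {0<..} = \<infinity>"
    and "continuous_on {0<..} c"
    and "antimono_on {0<..} c"
    and "\<exists>l::ereal. ((\<lambda>t. ereal (c t)) \<longlongrightarrow> l) (at_right 0) \<and> 0 < l"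
    and "open G" and "G \<noteq> {}" and "G \<subseteq> {0<..}"
    and "c differentiable_on G"
    and "continuous_density_condition M S g"
  shows "\<forall>B\<in>sets borel. B \<subseteq> G \<longrightarrow>
     {\<omega> \<in> space M. \<exists>t\<in>B. crossing_time S c \<omega> = ereal t \<and> S t \<omega> = c t} \<in> sets M \<and>
     emeasure M {\<omega> \<in> space M. \<exists>t\<in>B. crossing_time S c \<omega> = ereal t \<and> S t \<omega> = c t} =
       (\<integral>\<^sup>+ t\<in>B. ennreal (- deriv c t * g t (c t)) \<partial>lborel)"
proof (intro ballI impI)
  fix B :: "real set" assume B: "B \<in> sets borel" "B \<subseteq> G"
  interpret subordinator M S by fact
  define E where "E B = {\<omega> \<in> space M. \<exists>t\<in>B. crossing_time S c \<omega> = ereal t \<and> S t \<omega> = c t}" for B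
  define f where "f t = ennreal (- deriv c t * g t (c t))" for t
  obtain l u :: "nat \<Rightarrow> real" where lu: "\<And>n. l n \<le> u n" "\<And>n. {l n..u n} \<subseteq> G" "G = (\<Union>n. {l n<..u n})"
    by (rule open_countable_Union_intervals[OF assms(7,8)]) (rule that)
  define D where "D n = B \<inter> disjointed (\<lambda>n. {l n<..u n}) n" for n
  have D_sets: "D n \<in> sets borel" for n
    using B by (auto simp: D_def disjointed_def)
  have D_sub: "D n \<subseteq> {l n<..u n}" for n
    unfolding D_def by (rule order_trans[OF Int_lower2 disjointed_subset])
  have D_disj: "disjoint_family D"
    using disjoint_family_disjointed[of "\<lambda>n. {l n<..u n}"] by (auto simp: D_def disjoint_family_on_def)
  have D_UN: "(\<Union>n. D n) = B"
  proof -
    have "(\<Union>n. D n) = B \<inter> (\<Union>n. disjointed (\<lambda>n. {l n<..u n}) n)" unfolding D_def by blast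
    also have "\<dots> = B \<inter> G" unfolding UN_disjointed_eq lu(3)[symmetric] ..
    finally show ?thesis using B(2) by blast
  qed
  have diff: "c differentiable (at t)" if "t \<in> {l n..u n}" for n t
    using assms(10) subsetD[OF lu(2)[of n] that]
    unfolding differentiable_on_eq_differentiable_at[OF assms(7)] by blast
  have l: "0 < l n" for n
  proof -
    have "l n \<in> G" using subsetD[OF lu(2)[of n], of "l n"] lu(1)[of n] by simp
    then show ?thesis using assms(9) by auto
  qed
  have piece: "E (D n) \<in> sets M" "(\<lambda>t. f t * indicator (D n) t) \<in> borel_measurable borel"
    "emeasure M (E (D n)) = (\<integral>\<^sup>+t. f t * indicator (D n) t \<partial>lborel)" for n
    unfolding E_def f_def
    using crossing_on_interval[OF assms(2,11,4,5) l[of n] lu(1)[of n] diff[of _ n] D_sets[of n] D_sub[of n]]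
    by blast+
  have E_UN: "E B = (\<Union>n. E (D n))"
  proof -
    have "E (\<Union>n. D n) = (\<Union>n. E (D n))" unfolding E_def by blast
    then show ?thesis by (simp only: D_UN)
  qed
  have "disjoint_family (\<lambda>n. E (D n))"
    unfolding disjoint_family_on_def
  proof (intro ballI impI)
    fix m n :: nat assume "m \<noteq> n"
    then have "D m \<inter> D n = {}" using D_disj by (auto simp: disjoint_family_on_def)
    \<comment> \<open>Each sample point has one crossing time, so disjoint sets of times give
      disjoint events.\<close>
    moreover have "t = t'" if "crossing_time S c \<omega> = ereal t" "crossing_time S c \<omega> = ereal t'" for \<omega> t t'
      using that by simp
    ultimately show "E (D m) \<inter> E (D n) = {}" unfolding E_def by blast
  qed
  then have "emeasure M (E B) = (\<Sum>n. emeasure M (E (D n)))"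
    unfolding E_UN using piece(1) by (intro suminf_emeasure[symmetric]) auto
  also have "\<dots> = (\<Sum>n. \<integral>\<^sup>+t. f t * indicator (D n) t \<partial>lborel)"
    by (simp only: piece(3))
  also have "\<dots> = (\<integral>\<^sup>+t. (\<Sum>n. f t * indicator (D n) t) \<partial>lborel)"
    using piece(2) by (intro nn_integral_suminf[symmetric]) simp
  also have "\<dots> = (\<integral>\<^sup>+t. f t * indicator B t \<partial>lborel)"
    by (simp only: ennreal_suminf_cmult suminf_indicator[OF D_disj] D_UN)
  finally have "emeasure M (E B) = (\<integral>\<^sup>+t. f t * indicator B t \<partial>lborel)" .
  moreover have "E B \<in> sets M" unfolding E_UN using piece(1) by (intro sets.countable_UN) auto
  ultimately show "{\<omega> \<in> space M. \<exists>t\<in>B. crossing_time S c \<omega> = ereal t \<and> S t \<omega> = c t} \<in> sets M \<and>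
     emeasure M {\<omega> \<in> space M. \<exists>t\<in>B. crossing_time S c \<omega> = ereal t \<and> S t \<omega> = c t} =
       (\<integral>\<^sup>+ t\<in>B. ennreal (- deriv c t * g t (c t)) \<partial>lborel)"
    unfolding E_def f_def by blast
qed

end
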